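(* Let $1\le r\le n$ be integers, let $\mathcal{G}_{n,r}$ be the Grassmann manifold of $r$-dimensional subspaces of $\mathbb{R}^n$, and let $$\mathcal{P}=\{(V,W)\in\mathcal{G}_{n,r}\times\mathcal{G}_{n,r}\ :\ V\oplus W^{\perp}=\mathbb{R}^n\}.$$ Then $\mathcal{P}$ is open, dense, and connected in $\mathcal{G}_{n,r}\times\mathcal{G}_{n,r}$. Moreover, $\mathcal{P}$ is diffeomorphic to the set of rank-$r$ projection operators $$\mathbb{P}=\{P\in\mathbb{R}^{n\times n}\ :\ P^2=P\ \text{ and }\ \operatorname{rank}(P)=r\}.$$
   Context: $\mathbb{R}^n$ carries the Euclidean inner product and $W^{\perp}$ is the orthogonal complement of $W$. The Grassmann manifold $\mathcal{G}_{n,r}$ has its usual smooth structure, namely that of the quotient of the open set $\mathbb{R}^{n,r}_*$ of real $n\times r$ matrices with linearly independent columns by the right action of $GL_r$, the class of $X$ being identified with $\operatorname{Range}X$. As an open subset, $\mathcal{P}$ inherits its smooth structure from $\mathcal{G}_{n,r}\times\mathcal{G}_{n,r}$; $\mathbb{P}$ has its usual smooth structure as a submanifold of $\mathbb{R}^{n\times n}$. *)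

theory Defs
  imports "HOL-Analysis.Analysis"
begin

section \<open>Smooth functions\<close>

text \<open>Functions of class \<open>C\<^sup>k\<close>; meant for open sets \<open>S\<close>.\<close>

primrec Ck_on ::
  "nat \<Rightarrow> ('a::euclidean_space \<Rightarrow> 'b::euclidean_space) \<Rightarrow> 'a set \<Rightarrow> bool" where
  "Ck_on 0 f S \<longleftrightarrow> continuous_on S f"
| "Ck_on (Suc k) f S \<longleftrightarrow>
     (\<forall>x\<in>S. f differentiable (at x)) \<and>
     (\<forall>v. Ck_on k (\<lambda>x. frechet_derivative f (at x) v) S)"

text \<open>
  A function on an arbitrary set \<open>S\<close> is smooth if near each point of \<open>S\<close> it is the restriction
  of a smooth function on an open set.  For open \<open>S\<close>, and for \<open>S\<close> relatively open in a linear
  subspace, this is ordinary smoothness.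
\<close>

definition smooth_on :: "'a::euclidean_space set \<Rightarrow> ('a \<Rightarrow> 'b::euclidean_space) \<Rightarrow> bool" where
  "smooth_on S f \<longleftrightarrow>
     (\<forall>x\<in>S. \<exists>T g. open T \<and> x \<in> T \<and> (\<forall>k. Ck_on k g T) \<and> (\<forall>y\<in>S \<inter> T. f y = g y))"

section \<open>Smooth manifolds\<close>

text \<open>
  A chart is a pair of its domain and its coordinate map.  Coordinates take values in a linear
  subspace \<open>E\<close> of a Euclidean space \<open>'e\<close> instead of in a fixed space \<open>\<real>\<^sup>d\<close>: the dimension
  (here \<open>r (n - r)\<close>, which is zero if \<open>r = n\<close>) is not the dimension of an available type.
\<close>

type_synonym ('a, 'e) chart = "'a set \<times> ('a \<Rightarrow> 'e)"

definition topological_chart ::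
  "'a topology \<Rightarrow> 'e::euclidean_space set \<Rightarrow> ('a, 'e) chart \<Rightarrow> bool" where
  "topological_chart X E = (\<lambda>(U, \<phi>).
     subspace E \<and> openin X U \<and> openin (top_of_set E) (\<phi> ` U) \<and>
     homeomorphic_map (subtopology X U) (top_of_set (\<phi> ` U)) \<phi>)"

datatype ('a, 'e) manifold =
  Manifold (mtop: "'a topology") (atlas: "('a, 'e) chart set")

text \<open>
  The atlas need not be maximal.  Smoothness of a map is required at each point in some pair of
  charts around the point and its image; in particular both atlases have to cover.
\<close>

definition smooth_map ::
  "('a, 'd::euclidean_space) manifold \<Rightarrow> ('b, 'e::euclidean_space) manifold \<Rightarrow> ('a \<Rightarrow> 'b) \<Rightarrow> bool"
  where
  "smooth_map M N f \<longleftrightarrow>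
     continuous_map (mtop M) (mtop N) f \<and>
     (\<forall>p\<in>topspace (mtop M). \<exists>(U, \<phi>)\<in>atlas M. \<exists>(V, \<psi>)\<in>atlas N.
        p \<in> U \<and> f p \<in> V \<and>
        smooth_on (\<phi> ` {x \<in> U. f x \<in> V}) (\<psi> \<circ> f \<circ> inv_into U \<phi>))"

definition diffeomorphic ::
  "('a, 'd::euclidean_space) manifold \<Rightarrow> ('b, 'e::euclidean_space) manifold \<Rightarrow> bool" where
  "diffeomorphic M N \<longleftrightarrow>
     (\<exists>f g. smooth_map M N f \<and> smooth_map N M g \<and>
        (\<forall>x\<in>topspace (mtop M). g (f x) = x) \<and> (\<forall>y\<in>topspace (mtop N). f (g y) = y))"

definition prod_manifold ::
  "('a, 'd::euclidean_space) manifold \<Rightarrow> ('b, 'e::euclidean_space) manifold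
    \<Rightarrow> ('a \<times> 'b, 'd \<times> 'e) manifold" where
  "prod_manifold M N =
     Manifold (prod_topology (mtop M) (mtop N))
       {(U \<times> V, map_prod \<phi> \<psi>) | U \<phi> V \<psi>. (U, \<phi>) \<in> atlas M \<and> (V, \<psi>) \<in> atlas N}"

text \<open>The structure induced on an open subset \<open>S\<close>.\<close>

definition open_submanifold :: "('a, 'e) manifold \<Rightarrow> 'a set \<Rightarrow> ('a, 'e) manifold" where
  "open_submanifold M S =
     Manifold (subtopology (mtop M) S) {(U \<inter> S, \<phi>) | U \<phi>. (U, \<phi>) \<in> atlas M}"

text \<open>
  The structure of an embedded submanifold \<open>S\<close> of a Euclidean space: its charts are all
  diffeomorphisms from relatively open subsets of \<open>S\<close> onto relatively open subsets of linear
  subspaces.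
\<close>

definition euclidean_submanifold :: "'e::euclidean_space set \<Rightarrow> ('e, 'e) manifold" where
  "euclidean_submanifold S =
     Manifold (top_of_set S)
       {(U, \<phi>). (\<exists>E. topological_chart (top_of_set S) E (U, \<phi>)) \<and>
          smooth_on U \<phi> \<and> smooth_on (\<phi> ` U) (inv_into U \<phi>)}"

section \<open>Quotients\<close>

definition quotient_topology :: "'a topology \<Rightarrow> ('a \<Rightarrow> 'b) \<Rightarrow> 'b set \<Rightarrow> 'b topology" where
  "quotient_topology X q S =
     topology (\<lambda>U. U \<subseteq> S \<and> openin X {x \<in> topspace X. q x \<in> U})"

lemma openin_quotient_topology:
  "openin (quotient_topology X q S) U \<longleftrightarrow> U \<subseteq> S \<and> openin X {x \<in> topspace X. q x \<in> U}"
proof -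
  have "istopology (\<lambda>U. U \<subseteq> S \<and> openin X {x \<in> topspace X. q x \<in> U})"
    unfolding istopology_def
  proof (intro conjI allI impI)
    fix A B
    assume A: "A \<subseteq> S \<and> openin X {x \<in> topspace X. q x \<in> A}"
      and B: "B \<subseteq> S \<and> openin X {x \<in> topspace X. q x \<in> B}"
    show "A \<inter> B \<subseteq> S" using A by blast
    have "{x \<in> topspace X. q x \<in> A \<inter> B} =
        {x \<in> topspace X. q x \<in> A} \<inter> {x \<in> topspace X. q x \<in> B}" by blast
    then show "openin X {x \<in> topspace X. q x \<in> A \<inter> B}" using A B by auto
  next
    fix K
    assume K: "\<forall>U\<in>K. U \<subseteq> S \<and> openin X {x \<in> topspace X. q x \<in> U}"
    show "\<Union>K \<subseteq> S" using K by blast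
    have "{x \<in> topspace X. q x \<in> \<Union>K} = (\<Union>U\<in>K. {x \<in> topspace X. q x \<in> U})" by blast
    then show "openin X {x \<in> topspace X. q x \<in> \<Union>K}" using K by auto
  qed
  then show ?thesis by (simp add: quotient_topology_def)
qed

lemma topspace_quotient_topology:
  assumes "q ` topspace X \<subseteq> S"
  shows "topspace (quotient_topology X q S) = S"
proof -
  have "{x \<in> topspace X. q x \<in> S} = topspace X" using assms by blast
  then show ?thesis
    unfolding topspace_def[of "quotient_topology X q S"] openin_quotient_topology by auto
qed

text \<open>
  The quotient of an open subset \<open>M\<close> of a Euclidean space by the fibres of \<open>q\<close>, with point set
  \<open>S = q ` M\<close>.  Its smooth structure is the one for which \<open>q\<close> is a smooth submersion (it is unique
  if it exists): a homeomorphism \<open>\<phi>\<close> onto a relatively open subset of \<open>E\<close> is a chart iff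
  \<open>\<phi> \<circ> q\<close> is a smooth submersion into \<open>E\<close>.
\<close>

definition quotient_manifold ::
  "'m::euclidean_space set \<Rightarrow> ('m \<Rightarrow> 'a) \<Rightarrow> 'a set \<Rightarrow> ('a, 'e::euclidean_space) manifold" where
  "quotient_manifold M q S =
     Manifold (quotient_topology (top_of_set M) q S)
       {(U, \<phi>). \<exists>E. topological_chart (quotient_topology (top_of_set M) q S) E (U, \<phi>) \<and>
          smooth_on {x \<in> M. q x \<in> U} (\<phi> \<circ> q) \<and>
          (\<forall>x\<in>M. q x \<in> U \<longrightarrow> range (frechet_derivative (\<phi> \<circ> q) (at x)) = E)}"

section \<open>The Grassmann manifold and rank-\<open>r\<close> projections\<close>

text \<open>
  Throughout, \<open>n = CARD('n)\<close> and \<open>r = CARD('r)\<close>; \<open>n \<times> r\<close> matrices have type \<open>real^'r^'n\<close>.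
  In \<open>full_rank_matrices\<close>, injectivity is needed because \<open>columns X\<close> is only a set and
  forgets repeated columns.
\<close>

definition full_rank_matrices :: "(real^'r^'n) set" where
  "full_rank_matrices = {X. inj (\<lambda>j. column j X) \<and> independent (columns X)}"

definition mrange :: "real^'r^'n \<Rightarrow> (real^'n) set" where
  "mrange X = range ((*v) X)"

definition subspaces_of_dim :: "nat \<Rightarrow> (real^'n) set set" where
  "subspaces_of_dim d = {V. subspace V \<and> dim V = d}"

definition Grassmann ::
  "'n::finite itself \<Rightarrow> 'r::finite itself \<Rightarrow> ((real^'n) set, real^'r^'n) manifold" where
  "Grassmann _ _ =
     quotient_manifold (full_rank_matrices :: (real^'r^'n) set) mrange (subspaces_of_dim CARD('r))"

lemma topspace_Grassmann:
  "topspace (mtop (Grassmann TYPE('n::finite) TYPE('r::finite))) =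
     (subspaces_of_dim CARD('r) :: (real^'n) set set)"
proof -
  have "mrange X \<in> subspaces_of_dim CARD('r)" if "X \<in> full_rank_matrices" for X :: "real^'r^'n"
  proof -
    have inj: "inj (\<lambda>j. column j X)" and ind: "independent (columns X)"
      using that by (auto simp: full_rank_matrices_def)
    have cols: "columns X = range (\<lambda>j. column j X)"
      by (auto simp: columns_def)
    have "card (columns X) = CARD('r)"
      unfolding cols by (rule card_image[OF inj])
    moreover have "mrange X = span (columns X)"
    proof
      show "mrange X \<subseteq> span (columns X)"
        unfolding mrange_def using matrix_vector_mult_in_columnspace by blast
      have "columns X \<subseteq> mrange X"
        unfolding cols mrange_def by (metis image_subsetI matrix_vector_mult_basis rangeI)
      then show "span (columns X) \<subseteq> mrange X"
        unfolding mrange_def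
        by (intro span_minimal linear_subspace_image matrix_vector_mul_linear subspace_UNIV)
    qed
    ultimately show ?thesis
      using ind by (simp add: subspaces_of_dim_def dim_eq_card_independent)
  qed
  then show ?thesis
    by (auto simp: Grassmann_def quotient_manifold_def intro!: topspace_quotient_topology)
qed

definition direct_sum_UNIV :: "'a::euclidean_space set \<Rightarrow> 'a set \<Rightarrow> bool" where
  "direct_sum_UNIV V W \<longleftrightarrow> {v + w | v w. v \<in> V \<and> w \<in> W} = UNIV \<and> V \<inter> W = {0}"

definition transversal_pairs :: "nat \<Rightarrow> ((real^'n) set \<times> (real^'n) set) set" where
  "transversal_pairs d =
     {(V, W). V \<in> subspaces_of_dim d \<and> W \<in> subspaces_of_dim d \<and>
        direct_sum_UNIV V (orthogonal_comp W)}"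

definition rank_projections :: "nat \<Rightarrow> (real^'n^'n) set" where
  "rank_projections d = {P. P ** P = P \<and> rank P = d}"

end

theory Submission
  imports Defs
begin

text \<open>
  Write \<open>V = range X\<close> and \<open>W = range Y\<close>.  Then \<open>V \<oplus> W\<^sup>\<bottom> = \<real>\<^sup>n\<close> iff \<open>Y\<^sup>T X\<close> is invertible, and the
  projection onto \<open>V\<close> along \<open>W\<^sup>\<bottom>\<close> is \<open>X (Y\<^sup>T X)\<^sup>-\<^sup>1 Y\<^sup>T\<close>, with inverse correspondence
  \<open>P \<mapsto> (range P, range P\<^sup>T)\<close>.

  Openness holds because \<open>X \<mapsto> range X\<close> is an open map.  Density and connectedness rest on the fact
  that \<open>det (B + t C)\<close> is a nonzero polynomial in \<open>t\<close> as soon as \<open>B\<close> or \<open>C\<close> is invertible: it allows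
  one to perturb \<open>X\<close> to \<open>X + t Y\<close>, and it gives a subspace transversal to two given ones.  If
  \<open>Y\<^sup>T X = 1\<close>, a segment of matrices \<open>Z\<close> with \<open>Y\<^sup>T Z = 1\<close> joins \<open>(V, W)\<close> to \<open>(W, W)\<close>.

  For smoothness fix \<open>X\<close>, \<open>Y\<close> with \<open>Y\<^sup>T X = 1\<close>.  Near \<open>range X\<close> the Grassmannian is parametrized by
  \<open>A \<mapsto> range (X + A)\<close>, \<open>Y\<^sup>T A = 0\<close>, near \<open>range Y\<close> by \<open>B \<mapsto> range (Y + B)\<close>, \<open>X\<^sup>T B = 0\<close>, and the
  projection onto \<open>range (X + A)\<close> along \<open>(range (Y + B))\<^sup>\<bottom>\<close> is given the coordinate
  \<open>K = A Y\<^sup>T + X B\<^sup>T\<close>.  As \<open>K X = A\<close> and \<open>K\<^sup>T Y = B\<close>, both directions of the diffeomorphism are linear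
  in these coordinates.
\<close>

section \<open>Calculus of \<open>C\<^sup>k\<close> functions\<close>

text \<open>On an open set a derivative depends only on nearby values, so agreement of
  \<open>f\<close> and \<open>g\<close> passes to each directional derivative and the induction
  continues.\<close>

lemma Ck_on_cong:
  assumes "open T" and "\<And>x. x \<in> T \<Longrightarrow> f x = g x" and "Ck_on k f T"
  shows "Ck_on k g T"
  using assms
proof (induction k arbitrary: f g)
  case 0
  then show ?case by (simp cong: continuous_on_cong)
next
  case (Suc k)
  have eq: "frechet_derivative f (at x) = frechet_derivative g (at x)"
    and diff: "g differentiable (at x)" if "x \<in> T" for x
  proof -
    have "f differentiable (at x)" using Suc.prems(3) that by simp
    then show "frechet_derivative f (at x) = frechet_derivative g (at x)"
      by (rule frechet_derivative_transform_within_open[OF _ Suc.prems(1) that Suc.prems(2)])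
    show "g differentiable (at x)"
      using \<open>f differentiable (at x)\<close> Suc.prems(1,2) that
      unfolding differentiable_def by (metis has_derivative_transform_within_open)
  qed
  have "Ck_on k (\<lambda>x. frechet_derivative g (at x) v) T" for v
    by (rule Suc.IH[OF Suc.prems(1), of "\<lambda>x. frechet_derivative f (at x) v"])
      (use Suc.prems(3) eq in auto)
  then show ?case by (simp add: diff)
qed

text \<open>Lets an explicitly known derivative \<open>f'\<close> stand in for
  \<open>frechet_derivative\<close>; the closure properties proved below by induction on
  \<open>k\<close> advance through this rule.\<close>

lemma Ck_on_SucI:
  assumes "open T" and "\<And>x. x \<in> T \<Longrightarrow> (f has_derivative f' x) (at x)"
    and "\<And>v. Ck_on k (\<lambda>x. f' x v) T"
  shows "Ck_on (Suc k) f T"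
proof -
  have "f' x = frechet_derivative f (at x)" if "x \<in> T" for x
    using assms(2)[OF that] by (rule frechet_derivative_at)
  then show ?thesis
    using assms by (auto simp: differentiable_def intro!: Ck_on_cong[OF assms(1) _ assms(3)])
qed

lemma Ck_on_Suc_has_derivative:
  assumes "Ck_on (Suc k) f T" "x \<in> T"
  shows "(f has_derivative frechet_derivative f (at x)) (at x)"
  using assms by (simp add: frechet_derivative_works)

lemma Ck_on_SucD: "Ck_on (Suc k) f T \<Longrightarrow> Ck_on k f T"
proof (induction k arbitrary: f)
  case 0
  then show ?case
    by (auto intro!: continuous_at_imp_continuous_on differentiable_imp_continuous_within)
next
  case (Suc k)
  then show ?case by (metis Ck_on.simps(2))
qed

lemma Ck_on_const: "open T \<Longrightarrow> Ck_on k (\<lambda>x. c) T"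
proof (induction k arbitrary: c)
  case (Suc k)
  show ?case
    by (rule Ck_on_SucI[where f' = "\<lambda>x v. 0"]) (use Suc in auto)
qed simp

lemma Ck_on_add:
  assumes "open T" "Ck_on k f T" "Ck_on k g T"
  shows "Ck_on k (\<lambda>x. f x + g x) T"
  using assms
proof (induction k arbitrary: f g)
  case 0
  then show ?case by (simp add: continuous_on_add)
next
  case (Suc k)
  show ?case
    by (rule Ck_on_SucI[OF Suc.prems(1) has_derivative_add])
      (use Suc in \<open>auto intro: Ck_on_Suc_has_derivative\<close>)
qed


lemma Ck_on_bounded_linear:
  assumes "bounded_linear h" "open T" "Ck_on k g T"
  shows "Ck_on k (\<lambda>x. h (g x)) T"
  using assms(2,3)
proof (induction k arbitrary: g)
  case 0
  then show ?case using bounded_linear.continuous_on[OF assms(1)] by simp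
next
  case (Suc k)
  show ?case
    by (rule Ck_on_SucI[OF Suc.prems(1) bounded_linear.has_derivative[OF assms(1)]])
      (use Suc in \<open>auto intro: Ck_on_Suc_has_derivative\<close>)
qed

lemma Ck_on_ident: "open T \<Longrightarrow> Ck_on k (\<lambda>x. x) T"
proof (cases k)
  case (Suc k)
  assume T: "open T"
  show ?thesis unfolding Suc
    by (rule Ck_on_SucI[where f' = "\<lambda>x v. v"]) (use T in \<open>auto intro: Ck_on_const\<close>)
qed simp

text \<open>The product rule gives two terms, each pairing a derivative of class C^k with the other
  factor, which is brought down from C^(k+1) by \<open>Ck_on_SucD\<close>. For this reason
  \<open>f\<close> and \<open>g\<close> vary in the induction.\<close>

lemma Ck_on_bounded_bilinear:
  assumes "bounded_bilinear h" "open T" "Ck_on k f T" "Ck_on k g T"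
  shows "Ck_on k (\<lambda>x. h (f x) (g x)) T"
  using assms(2-)
proof (induction k arbitrary: f g)
  case 0
  then show ?case using bounded_bilinear.continuous_on[OF assms(1)] by simp
next
  case (Suc k)
  show ?case
  proof (rule Ck_on_SucI[OF Suc.prems(1) bounded_bilinear.FDERIV[OF assms(1)]])
    show "Ck_on k (\<lambda>x. h (f x) (frechet_derivative g (at x) v) +
        h (frechet_derivative f (at x) v) (g x)) T" for v
      by (intro Ck_on_add Suc.IH Suc.prems) (use Suc.prems in \<open>auto intro: Ck_on_SucD\<close>)
  qed (use Suc.prems in \<open>auto intro: Ck_on_Suc_has_derivative\<close>)
qed

lemma Ck_on_diff:
  assumes "open T" "Ck_on k f T" "Ck_on k g T"
  shows "Ck_on k (\<lambda>x. f x - g x) T"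
  using Ck_on_add[OF assms(1,2) Ck_on_bounded_linear[OF bounded_linear_minus[OF bounded_linear_ident] assms(1,3)]]
  by simp

lemma Ck_on_sum:
  assumes "open T" "\<And>i. i \<in> I \<Longrightarrow> Ck_on k (f i) T"
  shows "Ck_on k (\<lambda>x. \<Sum>i\<in>I. f i x) T"
  using assms
proof (induction I rule: infinite_finite_induct)
qed (auto intro: Ck_on_const Ck_on_add)

lemma Ck_on_prod:
  fixes f :: "'i \<Rightarrow> 'a::euclidean_space \<Rightarrow> real"
  assumes "open T" "\<And>i. i \<in> I \<Longrightarrow> Ck_on k (f i) T"
  shows "Ck_on k (\<lambda>x. \<Prod>i\<in>I. f i x) T"
  using assms
proof (induction I rule: infinite_finite_induct)
qed (auto intro: Ck_on_const Ck_on_bounded_bilinear[OF bounded_bilinear_mult])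

text \<open>The derivative of \<open>1/f\<close> is \<open>-(1/f) f' (1/f)\<close>, so the C^k
  regularity of \<open>1/f\<close> given by the induction hypothesis lifts itself to
  C^(k+1).\<close>

lemma Ck_on_inverse:
  fixes f :: "'a::euclidean_space \<Rightarrow> real"
  assumes "open T" "Ck_on k f T" "\<And>x. x \<in> T \<Longrightarrow> f x \<noteq> 0"
  shows "Ck_on k (\<lambda>x. inverse (f x)) T"
  using assms
proof (induction k)
  case 0
  then show ?case by (simp add: continuous_on_inverse)
next
  case (Suc k)
  have "Ck_on k f T" using Suc.prems(2) by (rule Ck_on_SucD)
  then have inv: "Ck_on k (\<lambda>x. inverse (f x)) T" using Suc by blast
  show ?case
  proof (rule Ck_on_SucI[OF Suc.prems(1)])
    show "((\<lambda>x. inverse (f x)) has_derivative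
        (\<lambda>v. - (inverse (f x) * frechet_derivative f (at x) v * inverse (f x)))) (at x)" if "x \<in> T" for x
      using Deriv.has_derivative_inverse[OF Suc.prems(3)[OF that] Ck_on_Suc_has_derivative[OF Suc.prems(2) that]] .
    show "Ck_on k (\<lambda>x. - (inverse (f x) * frechet_derivative f (at x) v * inverse (f x))) T" for v
      by (intro Ck_on_bounded_linear[OF bounded_linear_minus[OF bounded_linear_ident]]
            Ck_on_bounded_bilinear[OF bounded_bilinear_mult] inv)
        (use Suc.prems in auto)
  qed
qed

lemma Ck_on_componentwise:
  assumes "open T" "\<And>b. b \<in> Basis \<Longrightarrow> Ck_on k (\<lambda>x. f x \<bullet> b) T"
  shows "Ck_on k f T"
proof -
  have "Ck_on k (\<lambda>x. \<Sum>b\<in>Basis. (f x \<bullet> b) *\<^sub>R b) T"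
    by (intro Ck_on_sum Ck_on_bounded_bilinear[OF bounded_bilinear_scaleR] Ck_on_const assms)
  then show ?thesis by (simp add: euclidean_representation)
qed

section \<open>Determinants and matrix inversion\<close>

lemma Ck_on_det:
  fixes F :: "'a::euclidean_space \<Rightarrow> real^'n^'n"
  assumes "open T" "\<And>i j. Ck_on k (\<lambda>x. F x $ i $ j) T"
  shows "Ck_on k (\<lambda>x. det (F x)) T"
  unfolding det_def
  by (intro Ck_on_sum Ck_on_prod Ck_on_bounded_bilinear[OF bounded_bilinear_mult] Ck_on_const assms)

lemma bounded_linear_entry: "bounded_linear (\<lambda>A::real^'n^'m. A $ i $ j)"
  using bounded_linear_compose[OF bounded_linear_vec_nth bounded_linear_vec_nth] .

lemma
  fixes A :: "real^'n^'n"
  assumes "det A \<noteq> 0"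
  shows matrix_mult_inv: "A ** matrix_inv A = mat 1"
    and inv_matrix_mult: "matrix_inv A ** A = mat 1"
  using assms unfolding invertible_det_nz[symmetric] invertible_def matrix_inv_def
  by (metis (mono_tags, lifting) someI_ex)+

text \<open>Cramer's rule for the system whose right-hand side is the \<open>j\<close>-th unit
  vector and whose solution is column \<open>j\<close> of the inverse. It exhibits inversion as a
  rational map.\<close>

lemma matrix_inv_entry:
  fixes A :: "real^'n^'n"
  assumes "det A \<noteq> 0"
  shows "matrix_inv A $ i $ j = det (\<chi> k l. if l = i then axis j 1 $ k else A $ k $ l) / det A"
proof -
  have "A ** matrix_inv A = mat 1"
    using assms by (rule matrix_mult_inv)
  then have "A *v (matrix_inv A *v axis j 1) = axis j 1"
    by (simp add: matrix_vector_mul_assoc)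
  then have "matrix_inv A *v axis j 1 = (\<chi> k. det (\<chi> i l. if l = k then axis j 1 $ i else A $ i $ l) / det A)"
    using cramer[OF assms] by blast
  moreover have "matrix_inv A $ i $ j = (matrix_inv A *v axis j 1) $ i"
    by (simp add: matrix_vector_mult_basis column_def)
  ultimately show ?thesis by simp
qed

lemma Ck_on_matrix_inv:
  fixes F :: "'a::euclidean_space \<Rightarrow> real^'n^'n"
  assumes "open T" "Ck_on k F T" "\<And>x. x \<in> T \<Longrightarrow> det (F x) \<noteq> 0"
  shows "Ck_on k (\<lambda>x. matrix_inv (F x)) T"
proof (rule Ck_on_componentwise[OF assms(1)])
  fix b :: "real^'n^'n" assume "b \<in> Basis"
  then obtain i j where b: "b = axis i (axis j 1)"
    by (auto simp: Basis_vec_def)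
  have F: "Ck_on k (\<lambda>x. F x $ i $ j) T" for i j
    using Ck_on_bounded_linear[OF bounded_linear_entry assms(1,2)] .
  \<comment> \<open>The numerator matrix in Cramer's rule has column \<open>i\<close> replaced by a
    constant vector, so each entry is either constant or an entry of \<open>F x\<close>.\<close>
  have cof: "Ck_on k (\<lambda>x. (\<chi> a b. if b = i then axis j 1 $ a else F x $ a $ b) $ a $ b) T" for a b :: 'n
    using F by (cases "b = i") (auto intro: Ck_on_const assms(1))
  show "Ck_on k (\<lambda>x. matrix_inv (F x) \<bullet> b) T"
  proof (rule Ck_on_cong[OF assms(1)])
    show "Ck_on k (\<lambda>x. det (\<chi> k l. if l = i then axis j 1 $ k else F x $ k $ l) * inverse (det (F x))) T"
      by (intro Ck_on_bounded_bilinear[OF bounded_bilinear_mult] Ck_on_inverse Ck_on_det F cof assms)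
  qed (simp add: b inner_axis matrix_inv_entry assms(3) divide_inverse)
qed

lemma bounded_bilinear_matrix_mult:
  "bounded_bilinear ((**) :: real^'m^'n \<Rightarrow> real^'k^'m \<Rightarrow> real^'k^'n)"
  unfolding bilinear_conv_bounded_bilinear[symmetric] bilinear_def
  by (intro conjI allI linearI)
    (simp_all add: matrix_matrix_mult_def vec_eq_iff distrib_left distrib_right sum.distrib
      sum_distrib_left mult.assoc mult.left_commute)

lemma bounded_linear_transpose: "bounded_linear (transpose :: real^'m^'n \<Rightarrow> real^'n^'m)"
  unfolding linear_conv_bounded_linear[symmetric]
  by (intro linearI) (simp_all add: transpose_def vec_eq_iff)

lemmas Ck_on_intros = Ck_on_const Ck_on_ident Ck_on_add Ck_on_diff
  Ck_on_bounded_bilinear[OF bounded_bilinear_matrix_mult]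
  Ck_on_bounded_linear[OF bounded_linear_transpose]
  Ck_on_bounded_linear[OF bounded_linear_fst] Ck_on_bounded_linear[OF bounded_linear_snd]
  Ck_on_matrix_inv

text \<open>Every smoothness claim below is met by a single extension \<open>g\<close> on one open
  set containing \<open>S\<close>.\<close>

lemma smooth_onI:
  assumes "open T" "S \<subseteq> T" "\<And>k. Ck_on k g T" "\<And>x. x \<in> S \<Longrightarrow> f x = g x"
  shows "smooth_on S f"
  unfolding smooth_on_def
proof
  fix x assume "x \<in> S"
  then show "\<exists>T g. open T \<and> x \<in> T \<and> (\<forall>k. Ck_on k g T) \<and> (\<forall>y\<in>S \<inter> T. f y = g y)"
    using assms by (intro exI[of _ T] exI[of _ g]) auto
qed

text \<open>Continuity within \<open>S\<close> is local, and near each point \<open>f\<close>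
  coincides on \<open>S\<close> with a continuous \<open>g\<close>.\<close>

lemma smooth_on_imp_continuous_on:
  assumes "smooth_on S f" shows "continuous_on S f"
proof -
  have "continuous (at x within S) f" if "x \<in> S" for x
  proof -
    have "\<exists>T g. open T \<and> x \<in> T \<and> (\<forall>k. Ck_on k g T) \<and> (\<forall>y\<in>S \<inter> T. f y = g y)"
      using assms that unfolding smooth_on_def by (rule bspec)
    then obtain T g where T: "open T" "x \<in> T" "\<And>k. Ck_on k g T" "\<And>y. y \<in> S \<inter> T \<Longrightarrow> f y = g y"
      by blast
    then have "continuous_on T g" by (metis Ck_on.simps(1))
    then have "continuous (at x within S) g"
      using T(1,2) continuous_at_imp_continuous_at_within continuous_on_eq_continuous_at by blast
    moreover have "\<forall>\<^sub>F y in at x within S. g y = f y"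
      using T(1,2,4) unfolding eventually_at_topological by (metis IntI)
    ultimately show ?thesis
      using T(2,4) that unfolding continuous_within by (metis IntI tendsto_cong)
  qed
  then show ?thesis by (simp add: continuous_on_eq_continuous_within)
qed

section \<open>Frames, ranges and oblique projections\<close>

lemmas matrix_mult_add_left = bounded_bilinear.add_left[OF bounded_bilinear_matrix_mult]
lemmas matrix_mult_add_right = bounded_bilinear.add_right[OF bounded_bilinear_matrix_mult]
lemmas matrix_mult_diff_left = bounded_bilinear.diff_left[OF bounded_bilinear_matrix_mult]
lemmas matrix_mult_diff_right = bounded_bilinear.diff_right[OF bounded_bilinear_matrix_mult]
lemmas matrix_mult_scaleR_left = bounded_bilinear.scaleR_left[OF bounded_bilinear_matrix_mult]
lemmas matrix_mult_scaleR_right = bounded_bilinear.scaleR_right[OF bounded_bilinear_matrix_mult]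
lemmas matrix_mult_0_left [simp] = bounded_bilinear.zero_left[OF bounded_bilinear_matrix_mult]
lemmas matrix_mult_0_right [simp] = bounded_bilinear.zero_right[OF bounded_bilinear_matrix_mult]
lemmas matrix_mult_distribs = matrix_mult_add_left matrix_mult_add_right
  matrix_mult_diff_left matrix_mult_diff_right matrix_mult_scaleR_left matrix_mult_scaleR_right

lemmas transpose_add = linear_add[OF bounded_linear.linear[OF bounded_linear_transpose]]
lemmas transpose_diff = linear_diff[OF bounded_linear.linear[OF bounded_linear_transpose]]
lemmas transpose_0 [simp] = linear_0[OF bounded_linear.linear[OF bounded_linear_transpose]]

lemma matrix_mult_cancel:
  fixes A :: "real^'b^'a" and B :: "real^'a^'b" and C :: "real^'c^'a" and D :: "real^'a^'d"
  assumes "A ** B = mat 1"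
  shows "A ** (B ** C) = C" and "D ** A ** B = D"
  using assms by (simp add: matrix_mul_assoc) (metis assms matrix_mul_assoc matrix_mul_rid)

lemma matrix_inv_unique_left:
  fixes A B :: "real^'n^'n"
  assumes "A ** B = mat 1" shows "matrix_inv B = A" "det B \<noteq> 0"
proof -
  show "det B \<noteq> 0"
    using assms by (metis invertible_det_nz invertible_left_inverse)
  then show "matrix_inv B = A"
    using assms by (metis matrix_mult_inv matrix_mul_assoc matrix_mul_lid matrix_mul_rid)
qed

lemma transpose_matrix_inv:
  fixes A :: "real^'n^'n"
  assumes "det A \<noteq> 0"
  shows "transpose (matrix_inv A) = matrix_inv (transpose A)"
  by (rule matrix_inv_unique_left(1)[symmetric])
    (metis assms matrix_mult_inv matrix_transpose_mul transpose_mat)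

lemma det_matrix_inv_nz:
  fixes A :: "real^'n^'n"
  assumes "det A \<noteq> 0" shows "det (matrix_inv A) \<noteq> 0"
  using matrix_inv_unique_left(2)[OF matrix_mult_inv[OF assms]] .

section \<open>Full-rank matrices and Gram determinants\<close>

lemma det_nz_iff_ker: "det (A::real^'n^'n) \<noteq> 0 \<longleftrightarrow> (\<forall>x. A *v x = 0 \<longrightarrow> x = 0)"
  by (metis invertible_det_nz invertible_left_inverse matrix_left_invertible_ker)

text \<open>Distinct independent columns admit no linear relation indexed by column number.
  Conversely, an injective \<open>X\<close> maps the standard basis to distinct independent
  vectors.\<close>

lemma full_rank_iff_inj: "X \<in> full_rank_matrices \<longleftrightarrow> inj ((*v) X)"
  for X :: "real^'r^'n"
proof
  assume X: "X \<in> full_rank_matrices"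
  have cols: "columns X = range (\<lambda>j. column j X)" by (auto simp: columns_def)
  have inj: "inj (\<lambda>j. column j X)" and ind: "independent (columns X)"
    using X by (auto simp: full_rank_matrices_def)
  have "c i = 0" if "(\<Sum>i\<in>UNIV. c i *s column i X) = 0" for c i
  proof -
    \<comment> \<open>\<open>?d\<close> carries the coefficients from column indices to the columns
      themselves, which is well defined because no two columns coincide.\<close>
    let ?d = "\<lambda>v. c (inv (\<lambda>j. column j X) v)"
    have "(\<Sum>v\<in>columns X. ?d v *\<^sub>R v) = (\<Sum>i\<in>UNIV. c i *\<^sub>R column i X)"
      unfolding cols by (subst sum.reindex[OF inj])  (simp add: inv_f_f[OF inj])
    also have "\<dots> = 0" using that by (simp add: scalar_mult_eq_scaleR)
    finally have "?d (column i X) = 0"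
      using ind unfolding independent_explicit by (auto simp: cols)
    then show ?thesis by  (simp add: inv_f_f[OF inj])
  qed
  then show "inj ((*v) X)"
    using matrix_left_invertible_independent_columns matrix_left_invertible_injective by blast
next
  assume inj: "inj ((*v) X)"
  have col: "column j X = X *v axis j 1" for j by (simp add: matrix_vector_mult_basis)
  have "inj (\<lambda>j. column j X)"
    unfolding col by (intro injI) (use inj in \<open>auto dest!: injD simp: axis_eq_axis\<close>)
  moreover have "columns X = (*v) X ` Basis"
    by (auto simp: columns_def col Basis_vec_def)
  moreover have "independent ((*v) X ` Basis)"
    by (rule linear_independent_injective_image)
      (use inj in \<open>auto simp: independent_Basis intro: inj_on_subset\<close>)
  ultimately show "X \<in> full_rank_matrices" by (simp add: full_rank_matrices_def)
qed

lemma full_rank_iff_left_inverse: "X \<in> full_rank_matrices \<longleftrightarrow> (\<exists>B. B ** X = mat 1)"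
  for X :: "real^'r^'n"
  by (simp add: full_rank_iff_inj matrix_left_invertible_injective)

lemma full_rank_if_det_nz:
  fixes A :: "real^'n^'r"
  assumes "det (A ** X) \<noteq> 0" shows "X \<in> full_rank_matrices"
  unfolding full_rank_iff_left_inverse
  using inv_matrix_mult[OF assms] by (metis matrix_mul_assoc)

lemma full_rank_mult:
  fixes X :: "real^'r^'n"
  assumes "X \<in> full_rank_matrices" "det g \<noteq> 0"
  shows "X ** g \<in> full_rank_matrices"
  using assms unfolding full_rank_iff_left_inverse
  by (metis matrix_mul_assoc inv_matrix_mult matrix_mult_cancel(2))

text \<open>Pairing \<open>X^T X c = 0\<close> with \<open>c\<close> gives
  \<open>|X c|^2 = 0\<close>, and \<open>X\<close> is injective.\<close>

lemma det_gram_nz: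
  fixes X :: "real^'r^'n"
  assumes "X \<in> full_rank_matrices" shows "det (transpose X ** X) \<noteq> 0"
  unfolding det_nz_iff_ker
proof (intro allI impI)
  fix c assume "(transpose X ** X) *v c = 0"
  then have "((X *v c) v* X) \<bullet> c = 0"
    by (simp flip: matrix_vector_mul_assoc)
  then have "X *v c = 0" by (simp add: dot_lmul_matrix)
  then show "c = 0"
    using assms unfolding full_rank_iff_inj by (metis injD matrix_vector_mult_0_right)
qed

lemma continuous_on_det:
  fixes F :: "'a::topological_space \<Rightarrow> real^'n^'n"
  assumes "continuous_on S F" shows "continuous_on S (\<lambda>x. det (F x))"
  unfolding det_def
  by (intro continuous_intros bounded_linear.continuous_on[OF bounded_linear_entry] assms)

lemmas continuous_on_matrix_mult = bounded_bilinear.continuous_on[OF bounded_bilinear_matrix_mult]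
lemmas continuous_on_transpose = bounded_linear.continuous_on[OF bounded_linear_transpose]

lemma open_det_nz:
  fixes F :: "'a::topological_space \<Rightarrow> real^'n^'n"
  assumes "continuous_on UNIV F" shows "open {x. det (F x) \<noteq> 0}"
proof -
  have "open ((\<lambda>x. det (F x)) -` (- {0}))"
    by (intro open_vimage continuous_on_det assms) auto
  then show ?thesis by (simp add: vimage_def)
qed

lemma open_full_rank: "open (full_rank_matrices :: (real^'r^'n) set)"
proof -
  have eq: "full_rank_matrices = {X::real^'r^'n. det (transpose X ** X) \<noteq> 0}"
    using det_gram_nz full_rank_if_det_nz by auto
  show ?thesis
    unfolding eq by (intro open_det_nz continuous_on_matrix_mult continuous_on_transpose continuous_on_id)
qed

section \<open>Ranges and the right action of GL_r\<close>

lemma mrange_mult_subset: "mrange (Z ** C) \<subseteq> mrange Z"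
  by (auto simp: mrange_def simp flip: matrix_vector_mul_assoc)

text \<open>Every column of \<open>X\<close> is \<open>Z\<close> times some coefficient vector;
  these vectors form the columns of \<open>C\<close>.\<close>

lemma mrange_subset_imp_factor:
  assumes "mrange X \<subseteq> mrange Z" shows "\<exists>C. X = Z ** C"
proof -
  have "\<forall>i. \<exists>c. Z *v c = column i X"
    using assms unfolding mrange_def by (metis image_subset_iff matrix_vector_mult_basis rangeE rangeI subsetD)
  then obtain c where c: "\<And>i. Z *v c i = column i X" by metis
  have "X $ a $ i = (Z ** (\<chi> k i. c i $ k)) $ a $ i" for a i
    using arg_cong[OF c[of i], of "\<lambda>v. v $ a"]
    by (simp add: matrix_matrix_mult_def matrix_vector_mult_def column_def)
  then show ?thesis by (auto simp: vec_eq_iff)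
qed

lemma mrange_mult_invertible:
  assumes "det g \<noteq> 0" shows "mrange (X ** g) = mrange X"
  by (metis assms matrix_mult_cancel(2) matrix_mult_inv mrange_mult_subset subset_antisym)

text \<open>A left inverse \<open>B\<close> of \<open>X\<close> turns \<open>X = Z g\<close> into
  \<open>(B Z) g = 1\<close>, so \<open>g\<close> is invertible. With
  \<open>mrange_mult_invertible\<close> this identifies the fibres of \<open>mrange\<close> on
  full-rank matrices with the orbits of GL_r.\<close>

lemma mrange_eq_imp_factor:
  fixes X Z :: "real^'r^'n"
  assumes "X \<in> full_rank_matrices" "mrange X = mrange Z"
  shows "\<exists>g. det g \<noteq> 0 \<and> X = Z ** g"
proof -
  obtain g where g: "X = Z ** g" using mrange_subset_imp_factor assms(2) by blast
  then obtain B where "(B ** Z) ** g = mat 1"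
    using assms(1) unfolding full_rank_iff_left_inverse by (metis matrix_mul_assoc)
  then show ?thesis using g matrix_inv_unique_left(2) by blast
qed

lemma mrange_eq_span: "mrange X = span (columns X)"
proof
  show "mrange X \<subseteq> span (columns X)"
    unfolding mrange_def using matrix_vector_mult_in_columnspace by blast
  have "columns X \<subseteq> mrange X"
    by (auto simp: columns_def mrange_def simp flip: matrix_vector_mult_basis)
  then show "span (columns X) \<subseteq> mrange X"
    unfolding mrange_def
    by (intro span_minimal linear_subspace_image matrix_vector_mul_linear subspace_UNIV)
qed

lemma mrange_full_rank:
  fixes X :: "real^'r^'n"
  assumes "X \<in> full_rank_matrices" shows "mrange X \<in> subspaces_of_dim CARD('r)"
  using assms unfolding full_rank_iff_inj subspaces_of_dim_def mrange_def
  by (simp add: linear_subspace_image dim_image_eq)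

text \<open>A basis of \<open>V\<close>, enumerated by the index type \<open>'r\<close>, supplies
  the columns.\<close>

lemma ex_full_rank_mrange:
  assumes "V \<in> subspaces_of_dim CARD('r)"
  shows "\<exists>X\<in>full_rank_matrices. mrange (X::real^'r^'n) = V"
proof -
  obtain B where B: "B \<subseteq> V" "independent B" "V \<subseteq> span B" "card B = dim V"
    using basis_exists by blast
  have V: "span B = V"
    using B assms by (auto simp: subspaces_of_dim_def intro: span_minimal[THEN subsetD])
  have "finite B" "card (UNIV::'r set) = card B"
    using B assms by (auto simp: subspaces_of_dim_def independent_bound)
  then obtain f where f: "bij_betw f (UNIV::'r set) B"
    using finite_same_card_bij[of "UNIV::'r set" B] by auto
  let ?X = "(\<chi> a j. f j $ a) :: real^'r^'n"
  have col: "column j ?X = f j" for j by (simp add: column_def vec_eq_iff)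
  have "columns ?X = B"
    using f by (auto simp: columns_def col bij_betw_def)
  moreover have "inj (\<lambda>j. column j ?X)"
    using f by (auto simp: col bij_betw_def)
  ultimately have "?X \<in> full_rank_matrices" "mrange ?X = V"
    using B V by (auto simp: full_rank_matrices_def mrange_eq_span)
  then show ?thesis by blast
qed

section \<open>Transversality in terms of frames\<close>

lemma orthogonal_comp_mrange: "u \<in> orthogonal_comp (mrange Y) \<longleftrightarrow> transpose Y *v u = 0"
proof -
  have "u \<in> orthogonal_comp (mrange Y) \<longleftrightarrow> (\<forall>c. u \<bullet> (Y *v c) = 0)"
    by (auto simp: orthogonal_comp_def mrange_def orthogonal_def inner_commute)
  then show ?thesis
    by (metis dot_lmul_matrix inner_eq_zero_iff inner_zero_left transpose_matrix_vector)
qed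

text \<open>A kernel vector \<open>c\<close> of \<open>Y^T X\<close> gives a vector
  \<open>X c\<close> common to both summands. In the other direction, invertibility lets every
  vector be split and makes the intersection trivial.\<close>

lemma transversal_pairs_mrange:
  fixes X Y :: "real^'r^'n"
  assumes "X \<in> full_rank_matrices" "Y \<in> full_rank_matrices"
  shows "(mrange X, mrange Y) \<in> transversal_pairs CARD('r) \<longleftrightarrow> det (transpose Y ** X) \<noteq> 0"
proof
  assume "(mrange X, mrange Y) \<in> transversal_pairs CARD('r)"
  then have int: "mrange X \<inter> orthogonal_comp (mrange Y) = {0}"
    by (simp add: transversal_pairs_def direct_sum_UNIV_def)
  show "det (transpose Y ** X) \<noteq> 0"
    unfolding det_nz_iff_ker
  proof (intro allI impI)
    fix c assume "(transpose Y ** X) *v c = 0"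
    then have "X *v c \<in> mrange X \<inter> orthogonal_comp (mrange Y)"
      unfolding Int_iff orthogonal_comp_mrange matrix_vector_mul_assoc by (simp add: mrange_def)
    then have "X *v c = 0" using int by blast
    then show "c = 0"
      using assms(1) unfolding full_rank_iff_inj by (metis injD matrix_vector_mult_0_right)
  qed
next
  assume det: "det (transpose Y ** X) \<noteq> 0"
  have "u \<in> {v + w | v w. v \<in> mrange X \<and> w \<in> orthogonal_comp (mrange Y)}" for u
  proof -
    \<comment> \<open>\<open>?c\<close> solves \<open>Y^T X c = Y^T u\<close>, so that the remainder
      \<open>u - X c\<close> is annihilated by \<open>Y^T\<close>.\<close>
    let ?c = "matrix_inv (transpose Y ** X) *v (transpose Y *v u)"
    have "transpose Y *v (X *v ?c) = transpose Y *v u"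
      using matrix_mult_inv[OF det] by (simp add: matrix_vector_mul_assoc matrix_mul_assoc del: transpose_matrix_vector)
    then have "u - X *v ?c \<in> orthogonal_comp (mrange Y)"
      unfolding orthogonal_comp_mrange by (simp add: matrix_vector_mult_diff_distrib del: transpose_matrix_vector)
    moreover have "u = X *v ?c + (u - X *v ?c)" by simp
    moreover have "X *v ?c \<in> mrange X" by (simp add: mrange_def)
    ultimately show ?thesis by blast
  qed
  moreover have "v = 0" if v: "v \<in> mrange X" "v \<in> orthogonal_comp (mrange Y)" for v
  proof -
    obtain c where c: "v = X *v c" using v(1) unfolding mrange_def by blast
    then have "(transpose Y ** X) *v c = 0"
      using v(2) unfolding orthogonal_comp_mrange by (simp add: matrix_vector_mul_assoc del: transpose_matrix_vector)
    then show ?thesis using det c unfolding det_nz_iff_ker by auto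
  qed
  moreover have "0 \<in> mrange X" "0 \<in> orthogonal_comp (mrange Y)"
    unfolding orthogonal_comp_mrange by (auto simp: mrange_def intro: range_eqI[of _ _ 0])
  ultimately show "(mrange X, mrange Y) \<in> transversal_pairs CARD('r)"
    using mrange_full_rank[OF assms(1)] mrange_full_rank[OF assms(2)]
    by (auto simp: transversal_pairs_def direct_sum_UNIV_def)
qed

section \<open>Oblique projections\<close>

definition oblique_proj :: "real^'r^'n \<Rightarrow> real^'r^'n \<Rightarrow> real^'n^'n" where
  "oblique_proj X Y = X ** matrix_inv (transpose Y ** X) ** transpose Y"

lemma oblique_proj_mult:
  assumes "det (transpose Y ** X) \<noteq> 0" shows "oblique_proj X Y ** X = X"
  unfolding oblique_proj_def
  by (metis assms inv_matrix_mult matrix_mul_assoc matrix_mul_rid)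

lemma oblique_proj_idem:
  assumes "det (transpose Y ** X) \<noteq> 0"
  shows "oblique_proj X Y ** oblique_proj X Y = oblique_proj X Y"
  using oblique_proj_mult[OF assms] by (metis matrix_mul_assoc oblique_proj_def)

text \<open>The two matrices are transposes of each other; this makes transversality symmetric in
  the two frames.\<close>

lemma transpose_mult_det_commute:
  fixes X Y :: "real^'r^'n"
  shows "det (transpose Y ** X) = det (transpose X ** Y)"
  by (metis det_transpose matrix_transpose_mul transpose_transpose)

lemma transpose_oblique_proj:
  assumes "det (transpose Y ** X) \<noteq> 0"
  shows "transpose (oblique_proj X Y) = oblique_proj Y X"
  using assms by (simp add: oblique_proj_def matrix_transpose_mul transpose_matrix_inv matrix_mul_assoc)

text \<open>\<open>oblique_proj X Y\<close> is \<open>X\<close> times a matrix and fixes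
  \<open>X\<close>, which gives the two inclusions.\<close>

lemma mrange_oblique_proj:
  assumes "det (transpose Y ** X) \<noteq> 0" shows "mrange (oblique_proj X Y) = mrange X"
  by (metis assms matrix_mul_assoc mrange_mult_subset oblique_proj_def oblique_proj_mult subset_antisym)

lemma mrange_transpose_oblique_proj:
  assumes "det (transpose Y ** X) \<noteq> 0" shows "mrange (transpose (oblique_proj X Y)) = mrange Y"
  using assms mrange_oblique_proj[of X Y] transpose_mult_det_commute[of Y X]
  by (simp add: transpose_oblique_proj)

lemma rank_eq_dim_mrange: "rank A = dim (mrange A)"
  by (simp add: rank_dim_range mrange_def)

lemma oblique_proj_in_rank_projections:
  fixes X Y :: "real^'r^'n"
  assumes "det (transpose Y ** X) \<noteq> 0" shows "oblique_proj X Y \<in> rank_projections CARD('r)"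
  using oblique_proj_idem[OF assms] mrange_oblique_proj[OF assms]
    mrange_full_rank[OF full_rank_if_det_nz[OF assms]]
  by (simp add: rank_projections_def rank_eq_dim_mrange subspaces_of_dim_def)

text \<open>The inclusion of ranges gives \<open>Q P = P\<close>, since \<open>Q\<close> fixes its
  range. The inclusion for the transposes writes \<open>Q\<close> as a matrix times
  \<open>P\<close>, which gives \<open>Q P = Q\<close>.\<close>

lemma idempotent_eqI:
  fixes P Q :: "real^'n^'n"
  assumes "P ** P = P" "Q ** Q = Q" "mrange P \<subseteq> mrange Q"
    "mrange (transpose Q) \<subseteq> mrange (transpose P)"
  shows "P = Q"
proof -
  obtain C where "P = Q ** C" using mrange_subset_imp_factor assms(3) by blast
  then have "Q ** P = P" using assms(2) by (simp add: matrix_mul_assoc)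
  obtain D where "transpose Q = transpose P ** D" using mrange_subset_imp_factor assms(4) by blast
  then have "Q = transpose D ** P" by (metis matrix_transpose_mul transpose_transpose)
  then have "Q ** P = Q" using assms(1) by (metis matrix_mul_assoc)
  with \<open>Q ** P = P\<close> show ?thesis by simp
qed

lemma rank_projection_eqI:
  assumes "P \<in> rank_projections d" "Q \<in> rank_projections d" "mrange P = mrange Q"
    "mrange (transpose P) = mrange (transpose Q)"
  shows "P = Q"
  using assms by (auto simp: rank_projections_def intro!: idempotent_eqI)

lemma rank_projection_transpose:
  "P \<in> rank_projections d \<Longrightarrow> transpose P \<in> rank_projections d"
  by (simp add: rank_projections_def rank_transpose flip: matrix_transpose_mul)

lemma mrange_rank_projection:
  "P \<in> rank_projections d \<Longrightarrow> mrange P \<in> subspaces_of_dim d"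
  by (simp add: rank_projections_def rank_eq_dim_mrange subspaces_of_dim_def)
    (simp add: mrange_def linear_subspace_image)

text \<open>\<open>P\<close> fixes \<open>X\<close> and has \<open>Y^T\<close> as a right factor, so
  \<open>X\<close> is a matrix times \<open>Y^T X\<close>. A left inverse of \<open>X\<close> then
  yields a left inverse of \<open>Y^T X\<close>.\<close>

lemma det_nz_if_mrange_projection:
  fixes X Y :: "real^'r^'n"
  assumes P: "P ** P = P" and X: "X \<in> full_rank_matrices"
    and "mrange X = mrange P" "mrange Y = mrange (transpose P)"
  shows "det (transpose Y ** X) \<noteq> 0"
proof -
  obtain C where "X = P ** C" using mrange_subset_imp_factor assms(3) by blast
  then have "P ** X = X" using P by (simp add: matrix_mul_assoc)
  obtain D where "transpose P = Y ** D" using mrange_subset_imp_factor assms(4) by blast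
  then have "P = transpose D ** transpose Y" by (metis matrix_transpose_mul transpose_transpose)
  then have "transpose D ** (transpose Y ** X) = X" using \<open>P ** X = X\<close> by (simp add: matrix_mul_assoc)
  moreover obtain B where "B ** X = mat 1" using X full_rank_iff_left_inverse by blast
  ultimately have "(B ** transpose D) ** (transpose Y ** X) = mat 1" by (metis matrix_mul_assoc)
  then show ?thesis by (rule matrix_inv_unique_left)
qed

section \<open>Dual frames\<close>

lemma ex_dual_frame:
  fixes X Y :: "real^'r^'n"
  assumes "det (transpose Y ** X) \<noteq> 0"
  shows "\<exists>Z. mrange Z = mrange Y \<and> transpose Z ** X = mat 1"
proof (intro exI conjI)
  \<comment> \<open>Right multiplication by an invertible matrix keeps the range of
    \<open>Y\<close>, and with this factor the product of the transpose with \<open>X\<close>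
    becomes the identity.\<close>
  let ?Z = "Y ** matrix_inv (transpose (transpose Y ** X))"
  have det: "det (transpose (transpose Y ** X)) \<noteq> 0" using assms by (simp add: det_transpose)
  show "mrange ?Z = mrange Y" by (intro mrange_mult_invertible det_matrix_inv_nz det)
  have "transpose ?Z = matrix_inv (transpose Y ** X) ** transpose Y"
    using det by (simp add: matrix_transpose_mul transpose_matrix_inv)
  then show "transpose ?Z ** X = mat 1"
    using assms by (simp add: inv_matrix_mult flip: matrix_mul_assoc)
qed

lemma ex_dual_frame_projection:
  fixes P :: "real^'n^'n"
  assumes "P \<in> rank_projections CARD('r)"
  shows "\<exists>X Y :: real^'r^'n. transpose Y ** X = mat 1 \<and> mrange X = mrange P \<and> mrange Y = mrange (transpose P)"
proof -
  obtain X :: "real^'r^'n" where X: "X \<in> full_rank_matrices" "mrange X = mrange P"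
    using ex_full_rank_mrange mrange_rank_projection[OF assms] by blast
  obtain Y :: "real^'r^'n" where Y: "mrange Y = mrange (transpose P)"
    using ex_full_rank_mrange mrange_rank_projection[OF rank_projection_transpose[OF assms]] by blast
  have "det (transpose Y ** X) \<noteq> 0"
    using assms X Y by (intro det_nz_if_mrange_projection[of P]) (auto simp: rank_projections_def)
  then show ?thesis using ex_dual_frame X Y by metis
qed

section \<open>Determinants of matrix pencils\<close>

lemma ex_poly_det_pencil:
  fixes B C :: "real^'n^'n"
  shows "\<exists>p. \<forall>t. poly p t = det (B + t *\<^sub>R C)"
  \<comment> \<open>The witness is the Leibniz expansion with each entry replaced by the linear
    polynomial \<open>b + c t\<close>.\<close>
  by (intro exI[of _ "\<Sum>p | p permutes UNIV. [:of_int (sign p):] * (\<Prod>i\<in>UNIV. [:B $ i $ p i, C $ i $ p i:])"])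
    (simp add: det_def poly_sum poly_prod)

text \<open>One nonsingular member makes the determinant a nonzero polynomial in \<open>t\<close>.
  If \<open>B\<close> is invertible, that member is at \<open>t = 0\<close>; if only
  \<open>C\<close> is, it is found by reversing the pencil.\<close>

lemma finite_det_pencil_roots:
  fixes B C :: "real^'n^'n"
  assumes "det B \<noteq> 0 \<or> det C \<noteq> 0"
  shows "finite {t. det (B + t *\<^sub>R C) = 0}"
proof -
  have fin: "finite {t. det (B + t *\<^sub>R C) = 0}" if "det (B + s *\<^sub>R C) \<noteq> 0" for B C :: "real^'n^'n" and s
  proof -
    obtain p where p: "\<And>t. poly p t = det (B + t *\<^sub>R C)" using ex_poly_det_pencil by blast
    then have "p \<noteq> 0" using that by (metis poly_0)
    then have "finite {t. poly p t = 0}" by (rule poly_roots_finite)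
    then show ?thesis by (simp add: p)
  qed
  show ?thesis
  proof (cases "det B = 0")
    case False
    then show ?thesis by (intro fin[of _ 0]) simp
  next
    case True
    then have "finite {t. det (C + t *\<^sub>R B) = 0}" using assms by (intro fin[of _ 0]) simp
    \<comment> \<open>Excluding 0 as well makes \<open>s\<close> nonzero, and
      \<open>det (C + s B) = s^n det (B + (1/s) C)\<close> then shows that the original pencil is
      nonsingular at \<open>1/s\<close>.\<close>
    then have "finite (insert 0 {t. det (C + t *\<^sub>R B) = 0})" by simp
    then obtain s where s: "s \<noteq> 0" "det (C + s *\<^sub>R B) \<noteq> 0"
      using ex_new_if_finite[OF infinite_UNIV_char_0] by blast
    have "det (C + s *\<^sub>R B) = det (\<chi> i. s *s (B + (1/s) *\<^sub>R C) $ i)"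
      using s(1) by (intro arg_cong[of _ _ det]) (simp add: vec_eq_iff field_simps)
    also have "\<dots> = s ^ CARD('n) * det (B + (1/s) *\<^sub>R C)"
      by (subst det_rows_mul) simp
    finally show ?thesis using s by (intro fin[of _ "1/s"]) auto
  qed
qed

section \<open>Topology of the set of transversal pairs\<close>

lemma openin_Grassmann:
  "openin (mtop (Grassmann TYPE('n::finite) TYPE('r::finite))) U \<longleftrightarrow>
     U \<subseteq> subspaces_of_dim CARD('r) \<and> open {X \<in> full_rank_matrices. mrange (X::real^'r^'n) \<in> U}"
  by (auto simp: Grassmann_def quotient_manifold_def openin_quotient_topology
      openin_open_eq[OF open_full_rank])

lemma continuous_map_mrange:
  fixes F :: "'a::topological_space \<Rightarrow> real^'r^'n"
  assumes "continuous_on S F" "F ` S \<subseteq> full_rank_matrices"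
  shows "continuous_map (top_of_set S) (mtop (Grassmann TYPE('n) TYPE('r))) (\<lambda>x. mrange (F x))"
proof -
  have q: "continuous_map (top_of_set full_rank_matrices) (mtop (Grassmann TYPE('n) TYPE('r)))
      (mrange :: real^'r^'n \<Rightarrow> _)"
    unfolding continuous_map_def openin_Grassmann topspace_Grassmann
    by (auto simp: mrange_full_rank openin_open_eq[OF open_full_rank])
  have "continuous_map (top_of_set S) (top_of_set full_rank_matrices) F"
    using assms by (auto simp: continuous_map_in_subtopology)
  from continuous_map_compose[OF this q] show ?thesis by (simp add: o_def)
qed

text \<open>The saturation of \<open>A\<close> under right multiplication by invertible
  \<open>g\<close> is a union of preimages of \<open>A\<close> under continuous maps, hence open. So
  \<open>mrange\<close> is an open map.\<close>

lemma openin_mrange_image: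
  fixes A :: "(real^'r^'n) set"
  assumes "open A" "A \<subseteq> full_rank_matrices"
  shows "openin (mtop (Grassmann TYPE('n) TYPE('r))) (mrange ` A)"
proof -
  have "{X \<in> full_rank_matrices. mrange X \<in> mrange ` A} = (\<Union>g\<in>{g. det g \<noteq> 0}. (\<lambda>X. X ** g) -` A)"
    (is "?L = ?R")
  proof (intro equalityI subsetI)
    fix X assume "X \<in> ?L"
    then obtain Z where "Z \<in> A" "mrange Z = mrange X" by auto
    then show "X \<in> ?R" using mrange_eq_imp_factor[of Z X] assms(2) by auto
  next
    fix X assume "X \<in> ?R"
    then obtain g where g: "det g \<noteq> 0" "X ** g \<in> A" by auto
    then have "X = (X ** g) ** matrix_inv g"
      by (simp add: matrix_mult_inv flip: matrix_mul_assoc)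
    then have "X \<in> full_rank_matrices"
      using g assms(2) full_rank_mult[OF _ det_matrix_inv_nz[OF g(1)], of "X ** g"] by auto
    then show "X \<in> ?L" using g mrange_mult_invertible[OF g(1), of X] by (metis (mono_tags, lifting) CollectI imageI)
  qed
  moreover have "open ?R"
    by (intro open_UN ballI open_vimage assms continuous_on_matrix_mult continuous_on_id continuous_on_const)
  ultimately show ?thesis
    using assms(2) mrange_full_rank by (auto simp: openin_Grassmann)
qed

text \<open>Openness of \<open>mrange\<close> passes to the product: a box
  \<open>B \<times> C\<close> inside \<open>A\<close> is carried onto a box of open sets.\<close>

lemma openin_mrange_pair_image:
  fixes A :: "((real^'r^'n) \<times> (real^'r^'n)) set"
  assumes "open A" "A \<subseteq> full_rank_matrices \<times> full_rank_matrices"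
  shows "openin (prod_topology (mtop (Grassmann TYPE('n) TYPE('r))) (mtop (Grassmann TYPE('n) TYPE('r))))
    (map_prod mrange mrange ` A)"
  unfolding openin_prod_topology_alt
proof (intro allI impI)
  fix V W assume "(V, W) \<in> map_prod mrange mrange ` A"
  then obtain X Y where XY: "(X, Y) \<in> A" "V = mrange X" "W = mrange Y" by auto
  obtain B C where BC: "open B" "open C" "(X, Y) \<in> B \<times> C" "B \<times> C \<subseteq> A"
    using open_prod_elim[OF assms(1) XY(1)] by metis
  then have "B \<subseteq> full_rank_matrices" "C \<subseteq> full_rank_matrices" using assms(2) by auto
  moreover have "mrange ` B \<times> mrange ` C \<subseteq> map_prod mrange mrange ` A"
    using BC(4) by (auto simp flip: map_prod_surj_on)
  ultimately show "\<exists>U V'. openin (mtop (Grassmann TYPE('n) TYPE('r))) U \<and>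
      openin (mtop (Grassmann TYPE('n) TYPE('r))) V' \<and> V \<in> U \<and> W \<in> V' \<and>
      U \<times> V' \<subseteq> map_prod mrange mrange ` A"
    using openin_mrange_image BC XY
    by (intro exI[of _ "mrange ` B"] exI[of _ "mrange ` C"]) auto
qed

section \<open>Openness of the set of transversal pairs\<close>

lemma open_transversal_frames:
  "open {(X :: real^'r^'n, Y :: real^'r^'n). det (transpose Y ** X) \<noteq> 0}"
proof -
  have "open {z :: (real^'r^'n) \<times> (real^'r^'n). det (transpose (snd z) ** fst z) \<noteq> 0}"
    by (intro open_det_nz continuous_on_matrix_mult continuous_on_transpose continuous_intros)
  then show ?thesis by (simp add: case_prod_beta')
qed

lemma transversal_frames_full_rank:
  fixes X Y :: "real^'r^'n"
  assumes "det (transpose Y ** X) \<noteq> 0"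
  shows "X \<in> full_rank_matrices" "Y \<in> full_rank_matrices"
  using assms full_rank_if_det_nz transpose_mult_det_commute by metis+

text \<open>Reduces openness to the open mapping property of \<open>mrange\<close>, since the pairs
  of frames on the right form an open set.\<close>

lemma transversal_pairs_eq_image:
  "transversal_pairs CARD('r) =
     map_prod mrange mrange ` {(X :: real^'r^'n, Y :: real^'r^'n). det (transpose Y ** X) \<noteq> 0}"
proof (intro equalityI subsetI)
  fix p :: "(real^'n) set \<times> (real^'n) set"
  assume p: "p \<in> transversal_pairs CARD('r)"
  then have "fst p \<in> subspaces_of_dim CARD('r)" "snd p \<in> subspaces_of_dim CARD('r)"
    by (auto simp: transversal_pairs_def)
  then obtain X Y :: "real^'r^'n" where XY: "X \<in> full_rank_matrices" "Y \<in> full_rank_matrices"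
      "p = (mrange X, mrange Y)"
    using ex_full_rank_mrange by (metis prod.collapse)
  then show "p \<in> map_prod mrange mrange ` {(X :: real^'r^'n, Y :: real^'r^'n). det (transpose Y ** X) \<noteq> 0}"
    using p transversal_pairs_mrange[OF XY(1,2)] by force
next
  fix p :: "(real^'n) set \<times> (real^'n) set"
  assume "p \<in> map_prod mrange mrange ` {(X :: real^'r^'n, Y :: real^'r^'n). det (transpose Y ** X) \<noteq> 0}"
  then show "p \<in> transversal_pairs CARD('r)"
    using transversal_pairs_mrange transversal_frames_full_rank by force
qed

lemma transversal_pairs_mrangeI:
  fixes X Y :: "real^'r^'n"
  assumes "det (transpose Y ** X) \<noteq> 0"
  shows "(mrange X, mrange Y) \<in> transversal_pairs CARD('r)"
  using assms transversal_pairs_mrange transversal_frames_full_rank by blast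

lemma transversal_pairsE:
  assumes "(V, W) \<in> transversal_pairs CARD('r)"
  obtains X Y :: "real^'r^'n" where "det (transpose Y ** X) \<noteq> 0" "V = mrange X" "W = mrange Y"
proof -
  have "(V, W) \<in> map_prod mrange mrange ` {(X :: real^'r^'n, Y :: real^'r^'n). det (transpose Y ** X) \<noteq> 0}"
    using assms transversal_pairs_eq_image by auto
  then show thesis using that by auto
qed

lemma openin_transversal_pairs:
  "openin (prod_topology (mtop (Grassmann TYPE('n::finite) TYPE('r::finite)))
      (mtop (Grassmann TYPE('n) TYPE('r)))) (transversal_pairs CARD('r))"
  unfolding transversal_pairs_eq_image[where 'r='r]
  by (intro openin_mrange_pair_image open_transversal_frames)
    (use transversal_frames_full_rank in blast)

lemma topspace_Grassmann_prod:
  "topspace (prod_topology (mtop (Grassmann TYPE('n::finite) TYPE('r::finite)))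
      (mtop (Grassmann TYPE('n) TYPE('r)))) =
     (subspaces_of_dim CARD('r) :: (real^'n) set set) \<times> subspaces_of_dim CARD('r)"
  by (simp add: topspace_Grassmann)

lemma continuous_map_mrange_pair:
  fixes F H :: "'a::topological_space \<Rightarrow> real^'r^'n"
  assumes "continuous_on S F" "F ` S \<subseteq> full_rank_matrices"
    and "continuous_on S H" "H ` S \<subseteq> full_rank_matrices"
  shows "continuous_map (top_of_set S)
      (prod_topology (mtop (Grassmann TYPE('n) TYPE('r))) (mtop (Grassmann TYPE('n) TYPE('r))))
      (\<lambda>x. (mrange (F x), mrange (H x)))"
  unfolding continuous_map_pairwise o_def fst_conv snd_conv
  by (intro conjI continuous_map_mrange assms)

section \<open>Density\<close>

lemma closure_of_transversal_pairs:
  "prod_topology (mtop (Grassmann TYPE('n::finite) TYPE('r::finite)))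
      (mtop (Grassmann TYPE('n) TYPE('r))) closure_of transversal_pairs CARD('r) =
    subspaces_of_dim CARD('r) \<times> subspaces_of_dim CARD('r)"
  (is "?G closure_of ?PP = ?S \<times> ?S")
proof (intro equalityI subsetI)
  fix p assume p: "p \<in> ?S \<times> ?S"
  then obtain X Y :: "real^'r^'n" where XY: "X \<in> full_rank_matrices" "Y \<in> full_rank_matrices"
      "p = (mrange X, mrange Y)"
    using ex_full_rank_mrange by (metis mem_Times_iff prod.collapse)
  have "\<exists>q. q \<in> ?PP \<and> q \<in> T" if T: "p \<in> T" "openin ?G T" for T
  proof -
    \<comment> \<open>The second subspace stays fixed, while the first moves through the frames
      \<open>X + t Y\<close>, which start at \<open>X\<close> for \<open>t = 0\<close>.\<close>
    let ?q = "\<lambda>t. (mrange (X + t *\<^sub>R Y), mrange Y)"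
    let ?I = "{t. X + t *\<^sub>R Y \<in> full_rank_matrices}"
    have I: "open ?I"
      unfolding vimage_def[symmetric, of "\<lambda>t. X + t *\<^sub>R Y"] by (intro open_vimage open_full_rank continuous_intros)
    have "continuous_map (top_of_set ?I) ?G ?q"
      by (rule continuous_map_mrange_pair) (use XY in \<open>auto intro!: continuous_intros\<close>)
    then have "openin (top_of_set ?I) {t \<in> ?I. ?q t \<in> T}"
      using openin_continuous_map_preimage[OF _ T(2)] by fastforce
    then have "open {t \<in> ?I. ?q t \<in> T}" by (simp add: openin_open_eq[OF I])
    moreover have "0 \<in> {t \<in> ?I. ?q t \<in> T}" using XY T by simp
    \<comment> \<open>The parameters that stay inside \<open>T\<close> form a nonempty open set of
      reals, hence an infinite one, whereas transversality fails for only finitely many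
      \<open>t\<close> because \<open>Y^T Y\<close> is invertible.\<close>
    ultimately have inf: "infinite {t \<in> ?I. ?q t \<in> T}" using finite_imp_not_open by blast
    have "finite {t. det (transpose Y ** X + t *\<^sub>R (transpose Y ** Y)) = 0}"
      by (intro finite_det_pencil_roots disjI2 det_gram_nz XY)
    then have "\<not> {t \<in> ?I. ?q t \<in> T} \<subseteq> {t. det (transpose Y ** X + t *\<^sub>R (transpose Y ** Y)) = 0}"
      using inf finite_subset by blast
    then obtain t where "?q t \<in> T" "det (transpose Y ** X + t *\<^sub>R (transpose Y ** Y)) \<noteq> 0"
      by blast
    moreover have "transpose Y ** X + t *\<^sub>R (transpose Y ** Y) = transpose Y ** (X + t *\<^sub>R Y)"
      by (simp add: matrix_mult_distribs)
    ultimately have "?q t \<in> ?PP" using transversal_pairs_mrangeI by metis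
    with \<open>?q t \<in> T\<close> show ?thesis by blast
  qed
  then show "p \<in> ?G closure_of ?PP"
    using p unfolding in_closure_of topspace_Grassmann_prod by blast
qed (use closure_of_subset_topspace[of ?G ?PP] in \<open>auto simp: topspace_Grassmann\<close>)

section \<open>Connectedness\<close>

context
  fixes G :: "((real^'n::finite) set \<times> (real^'n) set) topology" and r :: "'r::finite itself"
  defines "G \<equiv> subtopology (prod_topology (mtop (Grassmann TYPE('n) TYPE('r))) (mtop (Grassmann TYPE('n) TYPE('r))))
      (transversal_pairs CARD('r))"
begin

text \<open>The image of the unit interval is a connected set containing both endpoints.\<close>

lemma transversal_pairs_path:
  fixes F H :: "real \<Rightarrow> real^'r^'n"
  assumes "continuous_on {0..1} F" "continuous_on {0..1} H"
    and det: "\<And>t. t \<in> {0..1} \<Longrightarrow> det (transpose (H t) ** F t) \<noteq> 0"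
  shows "connected_component_of G (mrange (F 0), mrange (H 0)) (mrange (F 1), mrange (H 1))"
proof -
  let ?q = "\<lambda>t. (mrange (F t), mrange (H t))"
  have "continuous_map (top_of_set {0..1}) G ?q"
    unfolding G_def continuous_map_in_subtopology
    using assms transversal_frames_full_rank[OF det] transversal_pairs_mrangeI[OF det]
    by (auto intro!: continuous_map_mrange_pair)
  then have "connectedin G (?q ` {0..1})"
    by (rule connectedin_continuous_map_image) (simp add: connectedin_subtopology)
  then show ?thesis
    unfolding connected_component_of_def by (rule_tac x = "?q ` {0..1}" in exI) auto
qed

text \<open>For fixed \<open>Y\<close> the equation \<open>Y^T F = 1\<close> is affine in
  \<open>F\<close>, so it persists along the segment from \<open>X\<close> to \<open>Z\<close> and
  keeps the determinant nonzero.\<close>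

lemma transversal_pairs_segment:
  fixes X Y Z :: "real^'r^'n"
  assumes "transpose Y ** X = mat 1" "transpose Y ** Z = mat 1"
  shows "connected_component_of G (mrange X, mrange Y) (mrange Z, mrange Y)"
    and "connected_component_of G (mrange Y, mrange X) (mrange Y, mrange Z)"
proof -
  let ?F = "\<lambda>t. (1 - t) *\<^sub>R X + t *\<^sub>R Z"
  have YF: "transpose Y ** ?F t = mat 1" for t
    using assms by (simp add: matrix_mult_distribs flip: scaleR_left.add)
  have cont: "continuous_on {0..1} ?F" by (intro continuous_intros)
  show "connected_component_of G (mrange X, mrange Y) (mrange Z, mrange Y)"
    using transversal_pairs_path[OF cont continuous_on_const[of _ Y]] YF by simp
  have "det (transpose (?F t) ** Y) \<noteq> 0" for t
    using YF transpose_mult_det_commute[of "?F t" Y] by simp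
  then show "connected_component_of G (mrange Y, mrange X) (mrange Y, mrange Z)"
    using transversal_pairs_path[OF continuous_on_const[of _ Y] cont] by simp
qed

lemma transversal_pairs_to_diagonal:
  fixes X Y :: "real^'r^'n"
  assumes "det (transpose Y ** X) \<noteq> 0"
  shows "connected_component_of G (mrange X, mrange Y) (mrange Y, mrange Y)"
    and "connected_component_of G (mrange Y, mrange X) (mrange Y, mrange Y)"
proof -
  obtain Z where Z: "mrange Z = mrange Y" "transpose Z ** X = mat 1"
    using ex_dual_frame[OF assms] by blast
  then have "Z \<in> full_rank_matrices"
    by (metis det_I full_rank_if_det_nz transversal_frames_full_rank(2) zero_neq_one)
  then have gram: "det (transpose Z ** Z) \<noteq> 0" by (rule det_gram_nz)
  \<comment> \<open>\<open>?Z\<close> spans the same subspace as \<open>Z\<close> and satisfies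
    \<open>Z^T ?Z = 1\<close>, just as \<open>X\<close> satisfies \<open>Z^T X = 1\<close>, so the
    segment from \<open>X\<close> to \<open>?Z\<close> ends on the diagonal.\<close>
  let ?Z = "Z ** matrix_inv (transpose Z ** Z)"
  have "transpose Z ** ?Z = mat 1" using matrix_mult_inv[OF gram] by (simp add: matrix_mul_assoc)
  moreover have "mrange ?Z = mrange Z" by (intro mrange_mult_invertible det_matrix_inv_nz gram)
  ultimately show "connected_component_of G (mrange X, mrange Y) (mrange Y, mrange Y)"
    and "connected_component_of G (mrange Y, mrange X) (mrange Y, mrange Y)"
    using transversal_pairs_segment[OF Z(2)] Z(1) by metis+
qed

text \<open>Some \<open>X + t Y\<close> works: in the first pencil the constant term
  \<open>X^T X\<close> is invertible, in the second the coefficient \<open>Y^T Y\<close> of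
  \<open>t\<close>, so only finitely many \<open>t\<close> are excluded.\<close>

lemma ex_common_transversal:
  fixes X Y :: "real^'r^'n"
  assumes "X \<in> full_rank_matrices" "Y \<in> full_rank_matrices"
  shows "\<exists>Z. det (transpose X ** Z) \<noteq> 0 \<and> det (transpose Y ** Z) \<noteq> 0"
proof -
  have "finite {t. det (transpose X ** X + t *\<^sub>R (transpose X ** Y)) = 0}"
    "finite {t. det (transpose Y ** X + t *\<^sub>R (transpose Y ** Y)) = 0}"
    using det_gram_nz[OF assms(1)] det_gram_nz[OF assms(2)] by (auto intro: finite_det_pencil_roots)
  then have "finite ({t. det (transpose X ** X + t *\<^sub>R (transpose X ** Y)) = 0} \<union>
      {t. det (transpose Y ** X + t *\<^sub>R (transpose Y ** Y)) = 0})" by simp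
  then obtain t where "det (transpose X ** X + t *\<^sub>R (transpose X ** Y)) \<noteq> 0"
    "det (transpose Y ** X + t *\<^sub>R (transpose Y ** Y)) \<noteq> 0"
    using ex_new_if_finite[OF infinite_UNIV_char_0] by blast
  then show ?thesis
    by (intro exI[of _ "X + t *\<^sub>R Y"]) (simp add: matrix_mult_distribs)
qed

text \<open>A \<open>Z\<close> transversal to both second components joins the diagonal points. With
  frames standing for their ranges, the chain is \<open>(X, Y)\<close>, \<open>(Y, Y)\<close>,
  \<open>(Z, Y)\<close>, \<open>(Z, Z)\<close>, \<open>(Z, Y')\<close>, \<open>(Y', Y')\<close>,
  \<open>(X', Y')\<close>, each link coming from
  \<open>transversal_pairs_to_diagonal\<close>.\<close>

lemma connected_transversal_pairs: "connected_space G"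
  unfolding connected_space_iff_connected_component
proof (intro ballI)
  fix p q assume pq: "p \<in> topspace G" "q \<in> topspace G"
  note sym = connected_component_of_sym[THEN iffD1] and [trans] = connected_component_of_trans
  obtain X Y :: "real^'r^'n" where XY: "det (transpose Y ** X) \<noteq> 0" "p = (mrange X, mrange Y)"
    using pq unfolding G_def by (metis IntE topspace_subtopology surj_pair transversal_pairsE)
  obtain X' Y' :: "real^'r^'n" where XY': "det (transpose Y' ** X') \<noteq> 0" "q = (mrange X', mrange Y')"
    using pq unfolding G_def by (metis IntE topspace_subtopology surj_pair transversal_pairsE)
  obtain Z where Z: "det (transpose Y ** Z) \<noteq> 0" "det (transpose Y' ** Z) \<noteq> 0"
    using ex_common_transversal transversal_frames_full_rank(2) XY(1) XY'(1) by blast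
  then have Z': "det (transpose Z ** Y) \<noteq> 0" "det (transpose Z ** Y') \<noteq> 0"
    using transpose_mult_det_commute by metis+
  have "connected_component_of G p (mrange Y, mrange Y)"
    using XY transversal_pairs_to_diagonal(1) by blast
  also have "connected_component_of G \<dots> (mrange Z, mrange Y)"
    using transversal_pairs_to_diagonal(1)[OF Z(1)] by (rule sym)
  also have "connected_component_of G \<dots> (mrange Z, mrange Z)"
    using transversal_pairs_to_diagonal(2)[OF Z'(1)] .
  also have "connected_component_of G \<dots> (mrange Z, mrange Y')"
    using transversal_pairs_to_diagonal(2)[OF Z'(2)] by (rule sym)
  also have "connected_component_of G \<dots> (mrange Y', mrange Y')"
    using transversal_pairs_to_diagonal(1)[OF Z(2)] .
  also have "connected_component_of G \<dots> q"
    unfolding XY'(2) using transversal_pairs_to_diagonal(1)[OF XY'(1)] by (rule sym)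
  finally show "connected_component_of G p q" .
qed

end

section \<open>Graph charts of the Grassmann manifold\<close>

text \<open>The model space of the charts: its elements are the matrices whose columns lie in the
  orthogonal complement of the range of \<open>Y\<close>.\<close>

definition dual_kernel :: "real^'r^'n \<Rightarrow> (real^'r^'n) set" where
  "dual_kernel Y = {A. transpose Y ** A = 0}"

text \<open>For \<open>Y^T X = 1\<close> and \<open>A\<close> in \<open>dual_kernel Y\<close> this
  is the graph of the linear map \<open>X c \<mapsto> A c\<close> from the range of \<open>X\<close>
  into the orthogonal complement of the range of \<open>Y\<close>.\<close>

definition frame_graph :: "real^'r^'n \<Rightarrow> real^'r^'n \<Rightarrow> (real^'n) set" where
  "frame_graph X A = mrange (X + A)"

definition graph_chart :: "real^'r^'n \<Rightarrow> real^'r^'n \<Rightarrow> ((real^'n) set, real^'r^'n) chart" where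
  "graph_chart X Y = (frame_graph X ` dual_kernel Y, inv_into (dual_kernel Y) (frame_graph X))"

lemma subspace_dual_kernel: "subspace (dual_kernel Y)"
  unfolding subspace_def dual_kernel_def
  by (simp add: matrix_mult_add_right matrix_mult_scaleR_right)

context
  fixes X Y :: "real^'r^'n"
  assumes dual: "transpose Y ** X = mat 1"
begin

abbreviation "graph_dom \<equiv> fst (graph_chart X Y)"
abbreviation "graph_coord \<equiv> snd (graph_chart X Y)"

lemma dual_kernel_frame: "A \<in> dual_kernel Y \<Longrightarrow> transpose Y ** (X + A) = mat 1"
  by (simp add: dual_kernel_def matrix_mult_add_right dual)

lemma dual_kernel_diff_iff: "Z - X \<in> dual_kernel Y \<longleftrightarrow> transpose Y ** Z = mat 1"
  by (simp add: dual_kernel_def matrix_mult_diff_right dual)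

lemma dual_kernel_full_rank: "A \<in> dual_kernel Y \<Longrightarrow> X + A \<in> full_rank_matrices"
  by (rule full_rank_if_det_nz[of "transpose Y"]) (simp add: dual_kernel_frame)

text \<open>The normalization \<open>Y^T (X + A) = 1\<close> selects one frame in each orbit: two
  such frames of the same subspace differ by a factor \<open>g\<close> that must be 1.\<close>

lemma inj_on_frame_graph: "inj_on (frame_graph X) (dual_kernel Y)"
proof (rule inj_onI)
  fix A B assume AB: "A \<in> dual_kernel Y" "B \<in> dual_kernel Y" "frame_graph X A = frame_graph X B"
  then obtain g where g: "X + A = (X + B) ** g"
    using mrange_eq_imp_factor[OF dual_kernel_full_rank[OF AB(1)]] unfolding frame_graph_def by blast
  then have "transpose Y ** (X + A) = (transpose Y ** (X + B)) ** g" by (simp add: matrix_mul_assoc)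
  then have "g = mat 1" using AB by (simp add: dual_kernel_frame)
  then show "A = B" using g by simp
qed

lemma graph_coord_frame_graph: "A \<in> dual_kernel Y \<Longrightarrow> graph_coord (frame_graph X A) = A"
  by (simp add: graph_chart_def inj_on_frame_graph)

lemma frame_graph_in_graph_dom: "A \<in> dual_kernel Y \<Longrightarrow> frame_graph X A \<in> graph_dom"
  by (simp add: graph_chart_def)

lemma graph_domE:
  assumes "V \<in> graph_dom"
  obtains A where "A \<in> dual_kernel Y" "V = mrange (X + A)" "graph_coord V = A"
  using assms graph_coord_frame_graph by (auto simp: graph_chart_def frame_graph_def)

lemma inj_on_graph_coord: "inj_on graph_coord graph_dom"
  by (rule inj_onI) (metis graph_domE)

lemma graph_coord_image: "graph_coord ` graph_dom = dual_kernel Y"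
  using graph_coord_frame_graph by (force simp: graph_chart_def)

text \<open>Among the frames of the range of \<open>Z\<close>, the one normalized by
  \<open>Y\<close> is \<open>Z (Y^T Z)^-1\<close>, and it has the form \<open>X + A\<close>.\<close>

lemma
  assumes "det (transpose Y ** Z) \<noteq> 0"
  shows mrange_in_graph_dom: "mrange Z \<in> graph_dom"
    and graph_coord_mrange: "graph_coord (mrange Z) = Z ** matrix_inv (transpose Y ** Z) - X"
proof -
  let ?A = "Z ** matrix_inv (transpose Y ** Z) - X"
  have "?A \<in> dual_kernel Y"
    using matrix_mult_inv[OF assms] by (simp add: dual_kernel_diff_iff matrix_mul_assoc)
  moreover have "mrange Z = frame_graph X ?A"
    by (simp add: frame_graph_def mrange_mult_invertible det_matrix_inv_nz assms)
  ultimately show "mrange Z \<in> graph_dom" "graph_coord (mrange Z) = ?A"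
    using frame_graph_in_graph_dom graph_coord_frame_graph by auto
qed

text \<open>The invertible factor \<open>g\<close> relating \<open>Z\<close> to the normalized frame
  \<open>X + A\<close> is \<open>Y^T Z\<close> itself.\<close>

lemma mrange_in_graph_dom_iff:
  assumes "Z \<in> full_rank_matrices"
  shows "mrange Z \<in> graph_dom \<longleftrightarrow> det (transpose Y ** Z) \<noteq> 0"
proof
  assume "mrange Z \<in> graph_dom"
  then obtain A where A: "A \<in> dual_kernel Y" "mrange Z = mrange (X + A)" by (rule graph_domE)
  then obtain g where g: "det g \<noteq> 0" "Z = (X + A) ** g"
    using mrange_eq_imp_factor[OF assms] by blast
  then have "transpose Y ** Z = g" by (simp add: matrix_mul_assoc dual_kernel_frame[OF A(1)])
  then show "det (transpose Y ** Z) \<noteq> 0" using g by simp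
qed (rule mrange_in_graph_dom)

lemma mrange_preimage_graph_dom:
  "{Z \<in> full_rank_matrices. mrange Z \<in> graph_dom} = {Z. det (transpose Y ** Z) \<noteq> 0}"
  using mrange_in_graph_dom_iff full_rank_if_det_nz by blast

section \<open>Graph coordinates as homeomorphisms and submersions\<close>

lemma open_mrange_preimage_graph_dom: "open {Z :: real^'r^'n. det (transpose Y ** Z) \<noteq> 0}"
  by (intro open_det_nz continuous_on_matrix_mult continuous_intros)

lemma Ck_on_normalized_frame:
  "Ck_on k (\<lambda>Z. Z ** matrix_inv (transpose Y ** Z) - X) {Z. det (transpose Y ** Z) \<noteq> 0}"
  by (intro Ck_on_intros open_mrange_preimage_graph_dom) auto

lemma Ck_on_graph_coord_mrange: "Ck_on k (graph_coord \<circ> mrange) {Z. det (transpose Y ** Z) \<noteq> 0}"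
  by (rule Ck_on_cong[OF open_mrange_preimage_graph_dom _ Ck_on_normalized_frame]) (simp add: graph_coord_mrange)

lemma openin_graph_dom: "openin (mtop (Grassmann TYPE('n) TYPE('r))) graph_dom"
  unfolding openin_Grassmann mrange_preimage_graph_dom
  using open_mrange_preimage_graph_dom mrange_full_rank[OF dual_kernel_full_rank] by (auto elim!: graph_domE)

text \<open>Openness in the quotient is tested on matrices, where the coordinate becomes the
  continuous function \<open>graph_coord \<circ> mrange\<close>. The inverse
  \<open>frame_graph X\<close> is continuous because it is \<open>mrange\<close> after a
  translation.\<close>

lemma homeomorphic_map_graph_coord:
  "homeomorphic_map (subtopology (mtop (Grassmann TYPE('n) TYPE('r))) graph_dom)
     (top_of_set (graph_coord ` graph_dom)) graph_coord"
proof -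
  let ?G = "mtop (Grassmann TYPE('n) TYPE('r))"
  have top: "topspace (subtopology ?G graph_dom) = graph_dom"
    using openin_subset[OF openin_graph_dom] by auto
  have "openin (subtopology ?G graph_dom) {V \<in> graph_dom. graph_coord V \<in> T}" if "open T" for T
  proof -
    have "{Z \<in> full_rank_matrices. mrange Z \<in> {V \<in> graph_dom. graph_coord V \<in> T}} =
        {Z. det (transpose Y ** Z) \<noteq> 0} \<inter> (graph_coord \<circ> mrange) -` T"
      using mrange_preimage_graph_dom by auto
    moreover have "open \<dots>"
      using continuous_open_preimage[OF _ open_mrange_preimage_graph_dom that] Ck_on_graph_coord_mrange[of 0] by simp
    ultimately show ?thesis
      using openin_subset[OF openin_graph_dom]
      by (auto simp: openin_open_subtopology[OF openin_graph_dom] openin_Grassmann topspace_Grassmann)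
  qed
  then have "continuous_map (subtopology ?G graph_dom) euclidean graph_coord"
    unfolding continuous_map_def top by auto
  moreover have "continuous_map (top_of_set (dual_kernel Y)) ?G (frame_graph X)"
    unfolding frame_graph_def
    by (rule continuous_map_mrange) (auto intro!: continuous_intros dual_kernel_full_rank)
  ultimately have "homeomorphic_maps (subtopology ?G graph_dom) (top_of_set (dual_kernel Y)) graph_coord (frame_graph X)"
    using graph_coord_image frame_graph_in_graph_dom
    by (auto simp: homeomorphic_maps_def continuous_map_in_subtopology top graph_coord_frame_graph
        elim!: graph_domE) (auto simp: frame_graph_def)
  then show ?thesis unfolding homeomorphic_map_maps graph_coord_image by blast
qed

text \<open>The coordinate takes values in the subspace \<open>dual_kernel Y\<close>, hence so does
  its derivative; explicit lines of matrices show that all of it is attained. This is the submersion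
  condition of the quotient structure.\<close>

lemma range_frechet_derivative_graph_coord_mrange:
  assumes "det (transpose Y ** Z) \<noteq> 0"
  shows "range (frechet_derivative (graph_coord \<circ> mrange) (at Z)) = dual_kernel Y"
proof -
  define D where "D = frechet_derivative (graph_coord \<circ> mrange) (at Z)"
  have D: "((graph_coord \<circ> mrange) has_derivative D) (at Z)"
    unfolding D_def using assms by (intro Ck_on_Suc_has_derivative[OF Ck_on_graph_coord_mrange]) simp
  have "((\<lambda>Z. transpose Y ** (graph_coord \<circ> mrange) Z) has_derivative (\<lambda>v. transpose Y ** D v)) (at Z)"
    by (rule bounded_linear.has_derivative[OF bounded_bilinear.bounded_linear_right D])
      (rule bounded_bilinear_matrix_mult)
  moreover have "transpose Y ** (graph_coord \<circ> mrange) Z' = 0" if "det (transpose Y ** Z') \<noteq> 0" for Z'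
    using mrange_in_graph_dom[OF that] graph_coord_image by (auto simp: dual_kernel_def)
  ultimately have "((\<lambda>Z. 0) has_derivative (\<lambda>v. transpose Y ** D v)) (at Z)"
    using assms by (elim has_derivative_transform_within_open[OF _ open_mrange_preimage_graph_dom]) auto
  then have "(\<lambda>v. transpose Y ** D v) = (\<lambda>v. 0)"
    using has_derivative_unique has_derivative_const by blast
  then have "range D \<subseteq> dual_kernel Y"
    by (auto simp: dual_kernel_def fun_eq_iff)
  moreover have "A \<in> range D" if A: "A \<in> dual_kernel Y" for A
  proof -
    \<comment> \<open>Moving \<open>Z\<close> in direction \<open>?B\<close> leaves
      \<open>Y^T Z\<close> unchanged, so the coordinate is affine in \<open>t\<close>, with velocity
      \<open>A\<close> by the choice of \<open>?B\<close>.\<close>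
    let ?B = "A ** (transpose Y ** Z)"
    have YB: "transpose Y ** ?B = 0" using A by (simp add: dual_kernel_def matrix_mul_assoc)
    then have YZ: "transpose Y ** (Z + t *\<^sub>R ?B) = transpose Y ** Z" for t
      by (simp add: matrix_mult_add_right matrix_mult_scaleR_right)
    have BN: "?B ** matrix_inv (transpose Y ** Z) = A"
      using matrix_mult_inv[OF assms] by (simp flip: matrix_mul_assoc)
    have "(graph_coord \<circ> mrange) (Z + t *\<^sub>R ?B) = (graph_coord \<circ> mrange) Z + t *\<^sub>R A" for t
      using assms
      by (simp add: graph_coord_mrange YZ matrix_mult_add_left matrix_mult_scaleR_left BN)
    moreover have "((\<lambda>t. (graph_coord \<circ> mrange) (Z + t *\<^sub>R ?B)) has_derivative (\<lambda>t. D (t *\<^sub>R ?B))) (at 0)"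
      by (rule has_derivative_compose[of "\<lambda>t. Z + t *\<^sub>R ?B" "\<lambda>t. t *\<^sub>R ?B" _ _ "graph_coord \<circ> mrange" D])
        (auto intro!: derivative_eq_intros D[simplified])
    ultimately have "((\<lambda>t. (graph_coord \<circ> mrange) Z + t *\<^sub>R A) has_derivative (\<lambda>t. D (t *\<^sub>R ?B))) (at 0)"
      by simp
    moreover have "((\<lambda>t. (graph_coord \<circ> mrange) Z + t *\<^sub>R A) has_derivative (\<lambda>t. t *\<^sub>R A)) (at 0)"
      by (auto intro!: derivative_eq_intros)
    ultimately have "(\<lambda>t. D (t *\<^sub>R ?B)) = (\<lambda>t. t *\<^sub>R A)" by (rule has_derivative_unique)
    from fun_cong[OF this, of 1] have "D ?B = A" by simp
    then show ?thesis by (metis rangeI)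
  qed
  ultimately show ?thesis unfolding D_def by blast
qed

lemma graph_chart_in_atlas: "graph_chart X Y \<in> atlas (Grassmann TYPE('n) TYPE('r))"
proof -
  have "topological_chart (mtop (Grassmann TYPE('n) TYPE('r))) (dual_kernel Y) (graph_dom, graph_coord)"
    unfolding topological_chart_def
    unfolding prod.case using homeomorphic_map_graph_coord openin_graph_dom
    by (simp add: subspace_dual_kernel graph_coord_image del: prod.collapse)
  moreover have "smooth_on {Z \<in> full_rank_matrices. mrange (Z :: real^'r^'n) \<in> graph_dom} (graph_coord \<circ> mrange)"
    unfolding mrange_preimage_graph_dom
    by (rule smooth_onI[OF open_mrange_preimage_graph_dom _ Ck_on_graph_coord_mrange]) auto
  moreover have "range (frechet_derivative (graph_coord \<circ> mrange) (at Z)) = dual_kernel Y"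
    if "Z \<in> full_rank_matrices" "mrange Z \<in> graph_dom" for Z :: "real^'r^'n"
    using that by (intro range_frechet_derivative_graph_coord_mrange) (simp add: mrange_in_graph_dom_iff)
  ultimately have "(graph_dom, graph_coord) \<in> atlas (Grassmann TYPE('n) TYPE('r))"
    by (auto simp: Grassmann_def quotient_manifold_def)
  then show ?thesis by simp
qed

end

section \<open>Charts of the manifold of projections\<close>

text \<open>For \<open>Y^T X = 1\<close> and \<open>P0 = X Y^T\<close>, the second condition is the
  linearization \<open>K = K P0 + P0 K\<close> of \<open>P^2 = P\<close>; the set is the tangent
  space of the projections at \<open>P0\<close>.\<close>

definition projection_tangent :: "real^'r^'n \<Rightarrow> real^'r^'n \<Rightarrow> (real^'n^'n) set" where
  "projection_tangent X Y =
     {K. transpose Y ** K ** X = 0 \<and> K = K ** X ** transpose Y + X ** transpose Y ** K}"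

text \<open>If \<open>Y^T X = 1\<close>, this is a relatively open neighbourhood of
  \<open>X Y^T\<close> among the projections: at that point the compression \<open>Y^T P X\<close>
  is the identity.\<close>

definition projection_dom :: "real^'r^'n \<Rightarrow> real^'r^'n \<Rightarrow> (real^'n^'n) set" where
  "projection_dom X Y = {P \<in> rank_projections CARD('r). det (transpose Y ** P ** X) \<noteq> 0}"

text \<open>Put \<open>N = (Y^T P X)^-1\<close>, \<open>Z = P X N\<close> and
  \<open>W^T = N Y^T P\<close>. The value is \<open>(Z - X) Y^T + X (W - Y)^T\<close>, where on
  \<open>projection_dom X Y\<close> the matrices \<open>Z\<close> and \<open>W\<close> are
  normalized frames of the ranges of \<open>P\<close> and \<open>P^T\<close>.\<close>

definition projection_coord :: "real^'r^'n \<Rightarrow> real^'r^'n \<Rightarrow> real^'n^'n \<Rightarrow> real^'n^'n" where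
  "projection_coord X Y P =
     P ** X ** matrix_inv (transpose Y ** P ** X) ** transpose Y +
     X ** matrix_inv (transpose Y ** P ** X) ** transpose Y ** P -
     (X ** transpose Y + X ** transpose Y)"

definition projection_param :: "real^'r^'n \<Rightarrow> real^'r^'n \<Rightarrow> real^'n^'n \<Rightarrow> real^'n^'n" where
  "projection_param X Y K = oblique_proj (X + K ** X) (Y + transpose K ** Y)"

lemma subspace_projection_tangent: "subspace (projection_tangent X Y)"
proof -
  have "linear (\<lambda>K. transpose Y ** K ** X)"
    "linear (\<lambda>K. K ** X ** transpose Y + X ** transpose Y ** K - K)"
    by (auto intro!: linearI simp: matrix_mult_distribs algebra_simps)
  then have "subspace ({K. transpose Y ** K ** X = 0} \<inter>
      {K. K ** X ** transpose Y + X ** transpose Y ** K - K = 0})"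
    by (intro subspace_inter linear_subspace_kernel)
  also have "\<dots> = projection_tangent X Y"
    by (auto simp: projection_tangent_def)
  finally show ?thesis .
qed

lemma open_projection_coord_dom: "open {P :: real^'n^'n. det (transpose Y ** P ** X) \<noteq> 0}"
  for X Y :: "real^'r^'n"
  by (intro open_det_nz continuous_on_matrix_mult continuous_intros)

lemma open_projection_param_dom:
  "open {K :: real^'n^'n. det (transpose (Y + transpose K ** Y) ** (X + K ** X)) \<noteq> 0}"
  for X Y :: "real^'r^'n"
  by (intro open_det_nz continuous_on_matrix_mult continuous_on_transpose continuous_intros)

lemma Ck_on_projection_coord:
  "Ck_on k (projection_coord X Y) {P. det (transpose Y ** P ** X) \<noteq> 0}"
  unfolding projection_coord_def[abs_def]
  by (intro Ck_on_intros open_projection_coord_dom) auto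

lemma Ck_on_projection_param:
  "Ck_on k (projection_param X Y) {K. det (transpose (Y + transpose K ** Y) ** (X + K ** X)) \<noteq> 0}"
  unfolding projection_param_def[abs_def] oblique_proj_def
  by (intro Ck_on_intros open_projection_param_dom) auto

lemma subspaces_of_dim_subset_eq:
  "V \<in> subspaces_of_dim d \<Longrightarrow> W \<in> subspaces_of_dim d \<Longrightarrow> V \<subseteq> W \<Longrightarrow> V = W"
  by (auto simp: subspaces_of_dim_def intro: subspace_dim_equal[THEN equalityD2, THEN subsetD])

text \<open>One inclusion always holds, and both subspaces have dimension
  \<open>CARD('r)\<close>.\<close>

lemma mrange_mult_full_rank_eq:
  fixes P :: "real^'n^'n" and X :: "real^'r^'n"
  assumes "P \<in> rank_projections CARD('r)" "P ** X \<in> full_rank_matrices"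
  shows "mrange (P ** X) = mrange P"
  using assms by (intro subspaces_of_dim_subset_eq[where d = "CARD('r)"])
    (auto simp: mrange_full_rank mrange_rank_projection intro: mrange_mult_subset[THEN subsetD])

section \<open>Projection charts at a pair of dual frames\<close>

context
  fixes X Y :: "real^'r^'n"
  assumes dual: "transpose Y ** X = mat 1"
begin

lemma dual_frame_swap: "transpose X ** Y = mat 1"
  using arg_cong[OF dual, of transpose] by (simp add: matrix_transpose_mul)

text \<open>In \<open>K X\<close> the second summand vanishes because \<open>B^T X = 0\<close>, and
  \<open>Y^T X = 1\<close> reduces the first to \<open>A\<close>; the transposed computation
  recovers \<open>B\<close>.\<close>

lemma projection_tangentI:
  assumes "transpose Y ** A = 0" "transpose X ** B = 0"
  defines "K \<equiv> A ** transpose Y + X ** transpose B"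
  shows "K \<in> projection_tangent X Y" "K ** X = A" "transpose K ** Y = B"
proof -
  have B: "transpose B ** X = 0"
    using arg_cong[OF assms(2), of transpose] by (simp add: matrix_transpose_mul)
  have A: "transpose A ** Y = 0"
    using arg_cong[OF assms(1), of transpose] by (simp add: matrix_transpose_mul)
  show KX: "K ** X = A"
    unfolding K_def matrix_mult_add_left by (simp add: dual B flip: matrix_mul_assoc)
  show "transpose K ** Y = B"
    unfolding K_def transpose_add matrix_transpose_mul transpose_transpose matrix_mult_add_left
    by (simp add: dual_frame_swap A flip: matrix_mul_assoc)
  have YK: "transpose Y ** K = transpose B"
    unfolding K_def matrix_mult_add_right by (simp add: matrix_mul_assoc dual assms(1))
  show "K \<in> projection_tangent X Y"
    unfolding projection_tangent_def mem_Collect_eq KX matrix_mul_assoc[symmetric, of X] YK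
    by (simp add: B) (simp add: K_def)
qed

lemma projection_tangentD:
  assumes "K \<in> projection_tangent X Y"
  shows "transpose Y ** (K ** X) = 0" "transpose X ** (transpose K ** Y) = 0"
    "K = (K ** X) ** transpose Y + X ** transpose (transpose K ** Y)"
proof -
  have K: "transpose Y ** K ** X = 0" "K = K ** X ** transpose Y + X ** transpose Y ** K"
    using assms by (auto simp: projection_tangent_def)
  show "transpose Y ** (K ** X) = 0" using K(1) by (simp add: matrix_mul_assoc)
  show "transpose X ** (transpose K ** Y) = 0"
    using arg_cong[OF K(1), of transpose] by (simp add: matrix_transpose_mul)
  show "K = (K ** X) ** transpose Y + X ** transpose (transpose K ** Y)"
    using K(2) by (simp add: matrix_transpose_mul matrix_mul_assoc)
qed

context
  fixes Z W :: "real^'r^'n"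
  assumes Z: "transpose Y ** Z = mat 1" and W: "transpose W ** X = mat 1"
    and WZ: "det (transpose W ** Z) \<noteq> 0"
begin

text \<open>The normalizations of \<open>Z\<close> and \<open>W\<close> cancel both outer
  factors.\<close>

lemma compress_oblique_proj:
  "transpose Y ** oblique_proj Z W ** X = matrix_inv (transpose W ** Z)"
  unfolding oblique_proj_def by (simp add: matrix_mul_assoc Z matrix_mult_cancel(2)[OF W])

lemma oblique_proj_in_projection_dom: "oblique_proj Z W \<in> projection_dom X Y"
  using oblique_proj_in_rank_projections[OF WZ] det_matrix_inv_nz[OF WZ]
  by (simp add: projection_dom_def compress_oblique_proj)

lemma projection_coord_oblique_proj:
  "projection_coord X Y (oblique_proj Z W) = (Z - X) ** transpose Y + X ** transpose (W - Y)"
proof -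
  let ?M = "transpose W ** Z"
  have inv: "matrix_inv (matrix_inv ?M) = ?M"
    by (rule matrix_inv_unique_left[OF matrix_mult_inv[OF WZ]])
  \<comment> \<open>Since the inverse of the compression is \<open>?M\<close>, this product and the
    next are the two normalized frames that enter the coordinate formula.\<close>
  have "oblique_proj Z W ** X ** ?M = Z"
    unfolding oblique_proj_def using inv_matrix_mult[OF WZ]
    by (simp add: matrix_mult_cancel(2)[OF W]) (metis matrix_mul_assoc matrix_mul_rid)
  moreover have "?M ** transpose Y ** oblique_proj Z W = transpose W"
  proof -
    have "transpose Y ** oblique_proj Z W = matrix_inv ?M ** transpose W"
      unfolding oblique_proj_def by (simp add: matrix_mul_assoc Z)
    then show ?thesis using matrix_mult_inv[OF WZ] by (metis matrix_mul_assoc matrix_mul_lid)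
  qed
  ultimately show ?thesis
    unfolding projection_coord_def compress_oblique_proj inv
    by (simp add: matrix_mult_diff_left matrix_mult_diff_right transpose_diff flip: matrix_mul_assoc)
qed

text \<open>The coordinate determines both frames through \<open>K X\<close> and
  \<open>K^T Y\<close>, which makes \<open>projection_param\<close> its inverse.\<close>

lemma projection_coord_in_tangent:
  "projection_coord X Y (oblique_proj Z W) \<in> projection_tangent X Y"
  "X + projection_coord X Y (oblique_proj Z W) ** X = Z"
  "Y + transpose (projection_coord X Y (oblique_proj Z W)) ** Y = W"
proof -
  have "transpose X ** W = mat 1"
    using arg_cong[OF W, of transpose] by (simp add: matrix_transpose_mul)
  then have *: "transpose Y ** (Z - X) = 0" "transpose X ** (W - Y) = 0"
    by (simp_all add: matrix_mult_diff_right dual dual_frame_swap Z)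
  show "projection_coord X Y (oblique_proj Z W) \<in> projection_tangent X Y"
    "X + projection_coord X Y (oblique_proj Z W) ** X = Z"
    "Y + transpose (projection_coord X Y (oblique_proj Z W)) ** Y = W"
    unfolding projection_coord_oblique_proj using projection_tangentI[OF *] by simp_all
qed

end

lemma projection_domE:
  assumes "P \<in> projection_dom X Y"
  obtains Z W where "transpose Y ** Z = mat 1" "transpose W ** X = mat 1"
    "det (transpose W ** Z) \<noteq> 0" "P = oblique_proj Z W"
proof -
  have P: "P \<in> rank_projections CARD('r)" "P ** P = P" and det: "det (transpose Y ** P ** X) \<noteq> 0"
    using assms by (auto simp: projection_dom_def rank_projections_def)
  let ?M = "transpose Y ** P ** X"
  let ?N = "matrix_inv ?M"
  \<comment> \<open>The columns come from \<open>P\<close> and its transpose, and the inverse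
    compression \<open>?N\<close> scales them to be dual to \<open>Y\<close> and \<open>X\<close>.
    Idempotence of \<open>P\<close> then gives \<open>W^T Z = N\<close>, hence
    transversality.\<close>
  let ?Z = "P ** X ** ?N" and ?W = "transpose P ** Y ** transpose ?N"
  have W: "transpose ?W = ?N ** transpose Y ** P"
    by (simp add: matrix_transpose_mul matrix_mul_assoc)
  have YZ: "transpose Y ** ?Z = mat 1"
    using matrix_mult_inv[OF det] by (simp add: matrix_mul_assoc)
  have WX: "transpose ?W ** X = mat 1"
    unfolding W using inv_matrix_mult[OF det] by (simp add: matrix_mul_assoc)
  have "transpose ?W ** ?Z = ?N ** transpose Y ** (P ** P) ** X ** ?N"
    unfolding W by (simp add: matrix_mul_assoc)
  also have "\<dots> = ?N ** ?M ** ?N" unfolding P(2) by (simp add: matrix_mul_assoc)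
  finally have WZ: "transpose ?W ** ?Z = ?N" by (simp add: inv_matrix_mult[OF det])
  then have nz: "det (transpose ?W ** ?Z) \<noteq> 0" by (simp add: det_matrix_inv_nz[OF det])
  note full = transversal_frames_full_rank[OF nz]
  have "mrange ?Z = mrange P"
    using mrange_mult_full_rank_eq[OF P(1), of "X ** ?N"] full(1) by (simp add: matrix_mul_assoc)
  moreover have "mrange ?W = mrange (transpose P)"
    using mrange_mult_full_rank_eq[OF rank_projection_transpose[OF P(1)], of "Y ** transpose ?N"] full(2)
    by (simp add: matrix_mul_assoc)
  ultimately have "P = oblique_proj ?Z ?W"
    by (intro rank_projection_eqI[OF P(1) oblique_proj_in_rank_projections[OF nz]])
      (simp_all add: mrange_oblique_proj[OF nz] mrange_transpose_oblique_proj[OF nz])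
  then show thesis using that YZ WX nz by blast
qed

text \<open>The image of the chart: the tangent matrices for which the two frames rebuilt from
  \<open>K\<close> are transversal.\<close>

definition "projection_params =
  {K \<in> projection_tangent X Y. det (transpose (Y + transpose K ** Y) ** (X + K ** X)) \<noteq> 0}"

lemma
  assumes "P \<in> projection_dom X Y"
  shows projection_coord_in_params: "projection_coord X Y P \<in> projection_params"
    and projection_param_coord: "projection_param X Y (projection_coord X Y P) = P"
proof -
  obtain Z W where ZW: "transpose Y ** Z = mat 1" "transpose W ** X = mat 1"
    "det (transpose W ** Z) \<noteq> 0" and P: "P = oblique_proj Z W"
    using projection_domE[OF assms] .
  show "projection_coord X Y P \<in> projection_params"
    unfolding projection_params_def P mem_Collect_eq projection_coord_in_tangent(2,3)[OF ZW]
    using projection_coord_in_tangent(1)[OF ZW] ZW(3) by blast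
  show "projection_param X Y (projection_coord X Y P) = P"
    unfolding projection_param_def P projection_coord_in_tangent(2,3)[OF ZW] ..
qed

lemma
  assumes "K \<in> projection_params"
  shows projection_param_in_dom: "projection_param X Y K \<in> projection_dom X Y"
    and projection_coord_param: "projection_coord X Y (projection_param X Y K) = K"
proof -
  have K: "K \<in> projection_tangent X Y"
    and det: "det (transpose (Y + transpose K ** Y) ** (X + K ** X)) \<noteq> 0"
    using assms by (auto simp: projection_params_def)
  note KD = projection_tangentD[OF K]
  have Z: "transpose Y ** (X + K ** X) = mat 1"
    by (simp add: matrix_mult_add_right dual KD(1))
  have "transpose X ** (Y + transpose K ** Y) = mat 1"
    by (simp add: matrix_mult_add_right dual_frame_swap KD(2))
  from arg_cong[OF this, of transpose] have W: "transpose (Y + transpose K ** Y) ** X = mat 1"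
    by (simp add: matrix_transpose_mul)
  show "projection_param X Y K \<in> projection_dom X Y"
    unfolding projection_param_def by (rule oblique_proj_in_projection_dom[OF Z W det])
  show "projection_coord X Y (projection_param X Y K) = K"
    unfolding projection_param_def projection_coord_oblique_proj[OF Z W det]
    using KD(3) by simp
qed

lemma projection_coord_image: "projection_coord X Y ` projection_dom X Y = projection_params"
  using projection_coord_in_params projection_param_in_dom projection_coord_param by (metis image_eqI subsetI subset_antisym image_subsetI)

lemma inj_on_projection_coord: "inj_on (projection_coord X Y) (projection_dom X Y)"
  by (rule inj_on_inverseI[of _ "projection_param X Y"]) (rule projection_param_coord)

lemma smooth_on_projection_coord: "smooth_on (projection_dom X Y) (projection_coord X Y)"
  by (rule smooth_onI[OF open_projection_coord_dom _ Ck_on_projection_coord])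
    (auto simp: projection_dom_def)

lemma smooth_on_projection_param: "smooth_on projection_params (projection_param X Y)"
  by (rule smooth_onI[OF open_projection_param_dom _ Ck_on_projection_param])
    (auto simp: projection_params_def)

text \<open>\<open>projection_coord\<close> and \<open>projection_param\<close> restrict rational
  maps defined on open sets of matrices. This yields relative openness of domain and image,
  smoothness both ways and, by continuity, the homeomorphism.\<close>

lemma projection_chart_in_atlas:
  "(projection_dom X Y, projection_coord X Y) \<in>
     atlas (euclidean_submanifold (rank_projections CARD('r)))"
proof -
  have dom: "projection_dom X Y \<subseteq> rank_projections CARD('r)"
    by (auto simp: projection_dom_def)
  have "openin (top_of_set (rank_projections CARD('r))) (projection_dom X Y)"
    using openin_open_Int[OF open_projection_coord_dom[of Y X], of "rank_projections CARD('r)"]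
    by (simp add: projection_dom_def Collect_conj_eq)
  moreover have "openin (top_of_set (projection_tangent X Y)) projection_params"
    using openin_open_Int[OF open_projection_param_dom[of Y X], of "projection_tangent X Y"]
    by (simp add: projection_params_def Collect_conj_eq)
  moreover have "homeomorphic_maps (top_of_set (projection_dom X Y)) (top_of_set projection_params)
      (projection_coord X Y) (projection_param X Y)"
    using smooth_on_imp_continuous_on[OF smooth_on_projection_coord]
      smooth_on_imp_continuous_on[OF smooth_on_projection_param]
    by (auto simp: homeomorphic_maps_def continuous_map_in_subtopology projection_coord_in_params
        projection_param_coord projection_param_in_dom projection_coord_param)
  ultimately have "topological_chart (top_of_set (rank_projections CARD('r)))
      (projection_tangent X Y) (projection_dom X Y, projection_coord X Y)"
    using dom by (auto simp: topological_chart_def subspace_projection_tangent projection_coord_image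
        subtopology_subtopology Int_absorb1 homeomorphic_map_maps)
  moreover have "smooth_on projection_params (inv_into (projection_dom X Y) (projection_coord X Y))"
  proof (rule smooth_onI[OF open_projection_param_dom _ Ck_on_projection_param])
    fix K assume K: "K \<in> projection_params"
    show "inv_into (projection_dom X Y) (projection_coord X Y) K = projection_param X Y K"
      using inv_into_f_f[OF inj_on_projection_coord projection_param_in_dom[OF K]]
      by (simp add: projection_coord_param[OF K])
  qed (auto simp: projection_params_def)
  ultimately show ?thesis
    using smooth_on_projection_coord by (auto simp: euclidean_submanifold_def projection_coord_image)
qed

end

section \<open>The diffeomorphism\<close>

definition range_corange :: "real^'n^'n \<Rightarrow> (real^'n) set \<times> (real^'n) set" where
  "range_corange P = (mrange P, mrange (transpose P))"

lemma inj_on_range_corange: "inj_on range_corange (rank_projections d)"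
  by (auto simp: range_corange_def intro!: inj_onI rank_projection_eqI)

lemma range_corange_oblique_proj:
  assumes "det (transpose Y ** X) \<noteq> 0"
  shows "range_corange (oblique_proj X Y) = (mrange X, mrange Y)"
  using assms by (simp add: range_corange_def mrange_oblique_proj mrange_transpose_oblique_proj)

lemma rank_projectionE:
  fixes P :: "real^'n^'n"
  assumes "P \<in> rank_projections CARD('r)"
  obtains X Y :: "real^'r^'n" where "transpose Y ** X = mat 1" "P = oblique_proj X Y"
proof -
  obtain X Y :: "real^'r^'n" where XY: "transpose Y ** X = mat 1" "mrange X = mrange P"
      "mrange Y = mrange (transpose P)"
    using ex_dual_frame_projection[OF assms] by blast
  then have det: "det (transpose Y ** X) \<noteq> 0" by simp
  have "P = oblique_proj X Y"
    by (rule rank_projection_eqI[OF assms oblique_proj_in_rank_projections[OF det]])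
      (simp_all add: XY mrange_oblique_proj[OF det] mrange_transpose_oblique_proj[OF det])
  then show thesis using that XY(1) by blast
qed

lemma transversal_pairs_dualE:
  assumes "p \<in> transversal_pairs CARD('r)"
  obtains X Y :: "real^'r^'n" where "transpose Y ** X = mat 1" "p = (mrange X, mrange Y)"
proof -
  obtain X Y :: "real^'r^'n" where "det (transpose Y ** X) \<noteq> 0" "p = (mrange X, mrange Y)"
    using assms by (metis surj_pair transversal_pairsE)
  then show thesis using ex_dual_frame that by metis
qed

lemma range_corange_in_transversal_pairs:
  "P \<in> rank_projections CARD('r::finite) \<Longrightarrow> range_corange P \<in> transversal_pairs CARD('r)"
  by (erule rank_projectionE) (simp add: range_corange_oblique_proj transversal_pairs_mrangeI)

text \<open>Defining it as an inverse makes it independent of frames;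
  \<open>pair_proj_mrange\<close> then gives its value in any frames.\<close>

definition pair_proj :: "nat \<Rightarrow> (real^'n) set \<times> (real^'n) set \<Rightarrow> real^'n^'n" where
  "pair_proj d = inv_into (rank_projections d) range_corange"

lemma pair_proj_range_corange:
  "P \<in> rank_projections d \<Longrightarrow> pair_proj d (range_corange P) = P"
  by (simp add: pair_proj_def inv_into_f_f inj_on_range_corange)

lemma pair_proj_mrange:
  fixes X Y :: "real^'r^'n"
  assumes "det (transpose Y ** X) \<noteq> 0"
  shows "pair_proj CARD('r) (mrange X, mrange Y) = oblique_proj X Y"
  using pair_proj_range_corange[OF oblique_proj_in_rank_projections[OF assms]]
  by (simp add: range_corange_oblique_proj[OF assms])

lemma range_corange_pair_proj:
  "p \<in> transversal_pairs CARD('r::finite) \<Longrightarrow> range_corange (pair_proj CARD('r) p) = p"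
  by (erule transversal_pairs_dualE) (simp add: pair_proj_mrange range_corange_oblique_proj)

lemma pair_proj_in_rank_projections:
  "p \<in> transversal_pairs CARD('r::finite) \<Longrightarrow> pair_proj CARD('r) p \<in> rank_projections CARD('r)"
  by (erule transversal_pairs_dualE) (simp add: pair_proj_mrange oblique_proj_in_rank_projections)

section \<open>Continuity and smoothness in both directions\<close>

context
  fixes M :: "((real^'n::finite) set \<times> (real^'n) set, (real^'r::finite^'n) \<times> (real^'r^'n)) manifold"
    and N :: "(real^'n^'n, real^'n^'n) manifold"
  defines "M \<equiv> open_submanifold (prod_manifold (Grassmann TYPE('n) TYPE('r)) (Grassmann TYPE('n) TYPE('r)))
      (transversal_pairs CARD('r))"
    and "N \<equiv> euclidean_submanifold (rank_projections CARD('r))"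
begin

lemma mtop_M: "mtop M = subtopology (prod_topology (mtop (Grassmann TYPE('n) TYPE('r)))
    (mtop (Grassmann TYPE('n) TYPE('r)))) (transversal_pairs CARD('r))"
  by (simp add: M_def open_submanifold_def prod_manifold_def)

lemma topspace_M: "topspace (mtop M) = transversal_pairs CARD('r)"
  unfolding mtop_M using openin_subset[OF openin_transversal_pairs] by auto

lemma mtop_N: "mtop N = top_of_set (rank_projections CARD('r))"
  by (simp add: N_def euclidean_submanifold_def)

lemma chart_in_atlas_M:
  fixes X Y :: "real^'r^'n"
  assumes "transpose Y ** X = mat 1"
  shows "((graph_dom X Y \<times> graph_dom Y X) \<inter> transversal_pairs CARD('r),
      map_prod (graph_coord X Y) (graph_coord Y X)) \<in> atlas M"
proof -
  have c: "(graph_dom X Y, graph_coord X Y) \<in> atlas (Grassmann TYPE('n) TYPE('r))"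
    "(graph_dom Y X, graph_coord Y X) \<in> atlas (Grassmann TYPE('n) TYPE('r))"
    using graph_chart_in_atlas[OF assms] graph_chart_in_atlas[OF dual_frame_swap[OF assms]] by simp_all
  have d: "(graph_dom X Y \<times> graph_dom Y X, map_prod (graph_coord X Y) (graph_coord Y X)) \<in>
      atlas (prod_manifold (Grassmann TYPE('n) TYPE('r)) (Grassmann TYPE('n) TYPE('r)))"
    unfolding prod_manifold_def manifold.sel by (intro CollectI exI) (rule conjI[OF refl conjI[OF c]])
  show ?thesis
    unfolding M_def open_submanifold_def manifold.sel by (intro CollectI exI) (rule conjI[OF refl d])
qed

lemma chart_in_atlas_N:
  fixes X Y :: "real^'r^'n"
  assumes "transpose Y ** X = mat 1"
  shows "(projection_dom X Y, projection_coord X Y) \<in> atlas N"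
  unfolding N_def using assms by (rule projection_chart_in_atlas)

lemma continuous_on_oblique_proj:
  "continuous_on {(X :: real^'r^'n, Y). det (transpose Y ** X) \<noteq> 0} (\<lambda>(X, Y). oblique_proj X Y)"
proof -
  have "Ck_on 0 (\<lambda>z. oblique_proj (fst z) (snd z)) {(X :: real^'r^'n, Y). det (transpose Y ** X) \<noteq> 0}"
    unfolding oblique_proj_def by (intro Ck_on_intros open_transversal_frames) auto
  then show ?thesis by (simp add: case_prod_beta')
qed

text \<open>On frames the map is the continuous function \<open>oblique_proj\<close>, so the
  preimage of an open set is the image under \<open>mrange\<close> of an open set of pairs of
  frames, hence open.\<close>

lemma continuous_map_pair_proj: "continuous_map (mtop M) (mtop N) (pair_proj CARD('r))"
  unfolding continuous_map_def topspace_M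
proof (intro conjI allI impI)
  show "pair_proj CARD('r) \<in> transversal_pairs CARD('r) \<rightarrow> topspace (mtop N)"
    by (simp add: mtop_N pair_proj_in_rank_projections)
  fix U assume "openin (mtop N) U"
  then obtain T where T: "open T" "U = rank_projections CARD('r) \<inter> T"
    by (auto simp: mtop_N openin_open)
  let ?A = "{(X :: real^'r^'n, Y). det (transpose Y ** X) \<noteq> 0} \<inter> (\<lambda>(X, Y). oblique_proj X Y) -` T"
  have "{p \<in> transversal_pairs CARD('r). pair_proj CARD('r) p \<in> U} = map_prod mrange mrange ` ?A"
  proof (intro equalityI subsetI)
    fix p assume p: "p \<in> {p \<in> transversal_pairs CARD('r). pair_proj CARD('r) p \<in> U}"
    then obtain X Y :: "real^'r^'n" where XY: "transpose Y ** X = mat 1" "p = (mrange X, mrange Y)"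
      using transversal_pairs_dualE by blast
    then have "(X, Y) \<in> ?A" using p T(2) by (simp add: pair_proj_mrange)
    then show "p \<in> map_prod mrange mrange ` ?A" by (rule rev_image_eqI) (simp add: XY(2))
  next
    fix p assume "p \<in> map_prod mrange mrange ` ?A"
    then show "p \<in> {p \<in> transversal_pairs CARD('r). pair_proj CARD('r) p \<in> U}"
      by (auto simp: T(2) pair_proj_mrange oblique_proj_in_rank_projections transversal_pairs_mrangeI)
  qed
  moreover have "open ?A"
    by (rule continuous_open_preimage[OF continuous_on_oblique_proj open_transversal_frames T(1)])
  then have "openin (prod_topology (mtop (Grassmann TYPE('n) TYPE('r))) (mtop (Grassmann TYPE('n) TYPE('r))))
      (map_prod mrange mrange ` ?A)"
    by (rule openin_mrange_pair_image) (use transversal_frames_full_rank in blast)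
  ultimately show "openin (mtop M) {p \<in> transversal_pairs CARD('r). pair_proj CARD('r) p \<in> U}"
    unfolding mtop_M openin_open_subtopology[OF openin_transversal_pairs]
    by (auto simp: transversal_pairs_mrangeI)
qed

text \<open>Fix a frame \<open>X\<close> of the range of \<open>P\<close>. Every projection
  \<open>Q\<close> for which \<open>Q X\<close> has full rank satisfies
  \<open>mrange Q = mrange (Q X)\<close>, so continuity at \<open>P\<close> reduces to that of
  \<open>Q \<mapsto> Q X\<close>.\<close>

lemma continuous_map_mrange_projection:
  "continuous_map (top_of_set (rank_projections CARD('r))) (mtop (Grassmann TYPE('n) TYPE('r))) mrange"
  unfolding continuous_map_def topspace_Grassmann
proof (intro conjI allI impI)
  fix U assume U: "openin (mtop (Grassmann TYPE('n) TYPE('r))) U"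
  let ?S = "{X \<in> full_rank_matrices. mrange (X :: real^'r^'n) \<in> U}"
  have "open ?S" using U by (simp add: openin_Grassmann)
  have "\<exists>T. openin (top_of_set (rank_projections CARD('r))) T \<and> P \<in> T \<and>
      T \<subseteq> {P \<in> rank_projections CARD('r). mrange P \<in> U}"
    if P: "P \<in> rank_projections CARD('r)" "mrange P \<in> U" for P
  proof -
    obtain X Y :: "real^'r^'n" where XY: "transpose Y ** X = mat 1" "P = oblique_proj X Y"
      using P(1) by (rule rank_projectionE)
    then have det: "det (transpose Y ** X) \<noteq> 0" by simp
    let ?T = "rank_projections CARD('r) \<inter> (\<lambda>P. P ** X) -` ?S"
    have "openin (top_of_set (rank_projections CARD('r))) ?T"
      by (intro openin_open_Int open_vimage \<open>open ?S\<close> continuous_on_matrix_mult continuous_intros)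
    moreover have "P ** X = X" using det by (simp add: XY(2) oblique_proj_mult)
    then have "P \<in> ?T"
      using P XY(2) full_rank_if_det_nz[OF det] by (simp add: mrange_oblique_proj[OF det])
    moreover have "?T \<subseteq> {P \<in> rank_projections CARD('r). mrange P \<in> U}"
      using mrange_mult_full_rank_eq by fastforce
    ultimately show ?thesis by blast
  qed
  then show "openin (top_of_set (rank_projections CARD('r)))
      {x \<in> topspace (top_of_set (rank_projections CARD('r))). mrange x \<in> U}"
    by (subst openin_subopen) simp
qed (simp add: mrange_rank_projection)

lemma continuous_map_range_corange: "continuous_map (mtop N) (mtop M) range_corange"
proof -
  have "continuous_map (top_of_set (rank_projections CARD('r) :: (real^'n^'n) set))
      (top_of_set (rank_projections CARD('r))) transpose"
    by (auto simp: continuous_map_in_subtopology rank_projection_transpose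
        intro: continuous_on_transpose continuous_intros)
  from continuous_map_compose[OF this continuous_map_mrange_projection] show ?thesis
    unfolding mtop_M mtop_N continuous_map_in_subtopology continuous_map_pairwise
    using continuous_map_mrange_projection
    by (auto simp: range_corange_in_transversal_pairs) (auto simp: o_def range_corange_def)
qed

lemma smooth_map_pair_proj: "smooth_map M N (pair_proj CARD('r))"
  unfolding smooth_map_def
proof (intro conjI ballI continuous_map_pair_proj)
  fix p assume "p \<in> topspace (mtop M)"
  then have p: "p \<in> transversal_pairs CARD('r)" by (simp add: topspace_M)
  then obtain X Y :: "real^'r^'n" where dual: "transpose Y ** X = mat 1" and pXY: "p = (mrange X, mrange Y)"
    by (rule transversal_pairs_dualE)
  note dual' = dual_frame_swap[OF dual]
  \<comment> \<open>The charts come from dual frames of \<open>p\<close> itself, so \<open>p\<close>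
    and its image are the origins of their charts.\<close>
  let ?U = "(graph_dom X Y \<times> graph_dom Y X) \<inter> transversal_pairs CARD('r)"
  let ?\<phi> = "map_prod (graph_coord X Y) (graph_coord Y X)"
  let ?V = "projection_dom X Y" and ?\<psi> = "projection_coord X Y" and ?f = "pair_proj CARD('r)"
  have "p \<in> ?U"
    using p mrange_in_graph_dom[OF dual, of X] mrange_in_graph_dom[OF dual', of Y] by (simp add: pXY dual dual')
  moreover have "?f p \<in> ?V"
    using oblique_proj_in_projection_dom[OF dual dual dual] by (simp add: pXY pair_proj_mrange dual)
  moreover have "smooth_on (?\<phi> ` {x \<in> ?U. ?f x \<in> ?V}) (?\<psi> \<circ> ?f \<circ> inv_into ?U ?\<phi>)"
  proof (rule smooth_onI[OF open_UNIV subset_UNIV])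
    \<comment> \<open>The coordinate expression is the restriction of the linear map
      \<open>(A, B) \<mapsto> A Y^T + X B^T\<close>, which is defined on the whole space.\<close>
    show "Ck_on k (\<lambda>z. fst z ** transpose Y + X ** transpose (snd z)) UNIV" for k
      by (intro Ck_on_intros) auto
    fix z assume "z \<in> ?\<phi> ` {x \<in> ?U. ?f x \<in> ?V}"
    then obtain q where q: "q \<in> ?U" "z = ?\<phi> q" by auto
    have "fst q \<in> graph_dom X Y" using q(1) by auto
    then obtain A where A: "A \<in> dual_kernel Y" "fst q = mrange (X + A)" "graph_coord X Y (fst q) = A"
      by (rule graph_domE[OF dual])
    have "snd q \<in> graph_dom Y X" using q(1) by auto
    then obtain B where B: "B \<in> dual_kernel X" "snd q = mrange (Y + B)" "graph_coord Y X (snd q) = B"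
      by (rule graph_domE[OF dual'])
    have "inj_on ?\<phi> ?U"
      by (rule inj_on_subset[OF map_prod_inj_on[OF inj_on_graph_coord[OF dual] inj_on_graph_coord[OF dual']]]) blast
    then have "(?\<psi> \<circ> ?f \<circ> inv_into ?U ?\<phi>) z = ?\<psi> (?f q)" using q by simp
    also have "q = (mrange (X + A), mrange (Y + B))" using A B by (metis prod.collapse)
    moreover have det: "det (transpose (Y + B) ** (X + A)) \<noteq> 0"
      using q(1) calculation dual_kernel_full_rank[OF dual A(1)] dual_kernel_full_rank[OF dual' B(1)]
      by (simp add: transversal_pairs_mrange)
    ultimately have "(?\<psi> \<circ> ?f \<circ> inv_into ?U ?\<phi>) z = ?\<psi> (oblique_proj (X + A) (Y + B))"
      by (simp add: pair_proj_mrange)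
    also have "\<dots> = A ** transpose Y + X ** transpose B"
    proof -
      have "transpose (Y + B) ** X = mat 1"
        using arg_cong[OF dual_kernel_frame[OF dual' B(1)], of transpose]
        by (simp add: matrix_transpose_mul)
      then show ?thesis
        using projection_coord_oblique_proj[OF dual dual_kernel_frame[OF dual A(1)] _ det] by simp
    qed
    also have "\<dots> = fst z ** transpose Y + X ** transpose (snd z)"
      using q(2) A(3) B(3) by simp
    finally show "(?\<psi> \<circ> ?f \<circ> inv_into ?U ?\<phi>) z = fst z ** transpose Y + X ** transpose (snd z)" .
  qed
  ultimately show "\<exists>(U, \<phi>)\<in>atlas M. \<exists>(V, \<psi>)\<in>atlas N. p \<in> U \<and> ?f p \<in> V \<and>
      smooth_on (\<phi> ` {x \<in> U. ?f x \<in> V}) (\<psi> \<circ> ?f \<circ> inv_into U \<phi>)"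
    by (intro bexI[OF _ chart_in_atlas_M[OF dual]] case_prodI bexI[OF _ chart_in_atlas_N[OF dual]] conjI)
qed

lemma smooth_map_range_corange: "smooth_map N M range_corange"
  unfolding smooth_map_def
proof (intro conjI ballI continuous_map_range_corange)
  fix P assume "P \<in> topspace (mtop N)"
  then have "P \<in> rank_projections CARD('r)" by (simp add: mtop_N)
  then obtain X Y :: "real^'r^'n" where dual: "transpose Y ** X = mat 1" and P: "P = oblique_proj X Y"
    by (rule rank_projectionE)
  note dual' = dual_frame_swap[OF dual]
  let ?U = "(graph_dom X Y \<times> graph_dom Y X) \<inter> transversal_pairs CARD('r)"
  let ?\<phi> = "map_prod (graph_coord X Y) (graph_coord Y X)"
  let ?V = "projection_dom X Y" and ?\<psi> = "projection_coord X Y"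
  have "P \<in> ?V"
    unfolding P by (rule oblique_proj_in_projection_dom[OF dual dual dual]) (simp add: dual)
  moreover have "range_corange P \<in> ?U"
    using mrange_in_graph_dom[OF dual, of X] mrange_in_graph_dom[OF dual', of Y]
    by (simp add: P range_corange_oblique_proj transversal_pairs_mrangeI dual dual')
  moreover have "smooth_on (?\<psi> ` {x \<in> ?V. range_corange x \<in> ?U}) (?\<phi> \<circ> range_corange \<circ> inv_into ?V ?\<psi>)"
  proof (rule smooth_onI[OF open_UNIV subset_UNIV])
    \<comment> \<open>The coordinate expression is the restriction of the linear map that recovers
      \<open>A\<close> and \<open>B\<close> from \<open>K\<close>.\<close>
    have "bounded_linear (\<lambda>K. (K ** X, transpose K ** Y))"
      by (intro bounded_linear_Pair bounded_linear_compose[OF bounded_bilinear.bounded_linear_left[OF bounded_bilinear_matrix_mult]]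
          bounded_linear_ident bounded_linear_transpose)
    then show "Ck_on k (\<lambda>K. (K ** X, transpose K ** Y)) UNIV" for k
      by (rule Ck_on_bounded_linear) (auto intro: Ck_on_ident)
    fix K assume "K \<in> ?\<psi> ` {x \<in> ?V. range_corange x \<in> ?U}"
    then obtain Q where Q: "Q \<in> ?V" "K = ?\<psi> Q" by auto
    obtain Z W where ZW: "transpose Y ** Z = mat 1" "transpose W ** X = mat 1"
      "det (transpose W ** Z) \<noteq> 0" and QZW: "Q = oblique_proj Z W"
      using projection_domE[OF dual Q(1)] .
    have K: "K \<in> projection_tangent X Y" "X + K ** X = Z" "Y + transpose K ** Y = W"
      unfolding Q(2) QZW by (rule projection_coord_in_tangent[OF dual ZW])+
    note KD = projection_tangentD[OF dual K(1)]
    have "(?\<phi> \<circ> range_corange \<circ> inv_into ?V ?\<psi>) K = ?\<phi> (range_corange Q)"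
      using Q inj_on_projection_coord[OF dual] by simp
    also have "range_corange Q = (mrange (X + K ** X), mrange (Y + transpose K ** Y))"
      unfolding K(2,3) by (simp add: QZW range_corange_oblique_proj[OF ZW(3)])
    also have "?\<phi> \<dots> = (K ** X, transpose K ** Y)"
      using KD(1,2) graph_coord_frame_graph[OF dual, of "K ** X"] graph_coord_frame_graph[OF dual', of "transpose K ** Y"]
      by (simp add: dual_kernel_def frame_graph_def)
    finally show "(?\<phi> \<circ> range_corange \<circ> inv_into ?V ?\<psi>) K = (K ** X, transpose K ** Y)" .
  qed
  ultimately show "\<exists>(U, \<phi>)\<in>atlas N. \<exists>(V, \<psi>)\<in>atlas M. P \<in> U \<and> range_corange P \<in> V \<and>
      smooth_on (\<phi> ` {x \<in> U. range_corange x \<in> V}) (\<psi> \<circ> range_corange \<circ> inv_into U \<phi>)"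
    by (intro bexI[OF _ chart_in_atlas_N[OF dual]] case_prodI bexI[OF _ chart_in_atlas_M[OF dual]] conjI)
qed

lemma diffeomorphic_transversal_pairs: "diffeomorphic M N"
  unfolding diffeomorphic_def topspace_M
  by (intro exI[of _ "pair_proj CARD('r)"] exI[of _ range_corange] conjI
      smooth_map_pair_proj smooth_map_range_corange)
    (simp_all add: mtop_N range_corange_pair_proj pair_proj_range_corange)

end

theorem theorem3p1:
  fixes GG :: "((real^'n::finite) set \<times> (real^'n) set, (real^'r::finite^'n) \<times> (real^'r^'n)) manifold"
    and PP :: "((real^'n) set \<times> (real^'n) set) set"
  assumes "CARD('r) \<le> CARD('n)"
    and "GG = prod_manifold (Grassmann TYPE('n) TYPE('r)) (Grassmann TYPE('n) TYPE('r))"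
    and "PP = transversal_pairs CARD('r)"
  shows "openin (mtop GG) PP \<and>
         (mtop GG) closure_of PP = topspace (mtop GG) \<and>
         connectedin (mtop GG) PP \<and>
         diffeomorphic (open_submanifold GG PP)
           (euclidean_submanifold (rank_projections CARD('r) :: (real^'n^'n) set))"
proof -
  have "mtop GG = prod_topology (mtop (Grassmann TYPE('n) TYPE('r))) (mtop (Grassmann TYPE('n) TYPE('r)))"
    by (simp add: assms(2) prod_manifold_def)
  moreover note openin_transversal_pairs[where 'n='n and 'r='r]
    closure_of_transversal_pairs[where 'n='n and 'r='r]
    connected_transversal_pairs[where 'n='n and 'r='r]
  ultimately show ?thesis
    using openin_subset[OF openin_transversal_pairs[where 'n='n and 'r='r]]
      diffeomorphic_transversal_pairs[where 'n='n and 'r='r]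
    unfolding assms(2,3) connectedin_def by (simp add: topspace_Grassmann)
qed

end
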